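(* For every finite graph $G$ on $n$ vertices with minimum degree at least $2$, we have $\gamma_g(G) \leq \frac{10}{17}n+\frac{1}{17}$.
   Context: Graphs are finite, simple and undirected. The domination game is played on a graph $G$ without isolated vertices by two players, Dominator and Staller, who alternately select vertices of $G$. A vertex is dominated if it or one of its neighbours has been selected by either player. Each player must always select a vertex that increases the number of dominated vertices. The game ends once all vertices of $G$ are dominated. Dominator wishes to minimize the total number of moves played (moves of both players are counted), while Staller wishes to maximize it. The game domination number $\gamma_g(G)$ is the number of moves the game takes to finish if Dominator moves first and both players play optimally. *)

theory Defs
  imports "Graph_Theory.Pair_Digraph"
begin

text \<open>
  A finite simple undirected graph is a finite symmetric loop-free \<^locale>\<open>pair_graph\<close>: each
  undirected edge is represented by both of its orientations, so the degree of a vertex is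
  its \<^const>\<open>out_degree\<close>.
\<close>

context pair_graph
begin

definition dominated :: "'a set \<Rightarrow> 'a set" where
  "dominated S = {v \<in> pverts G. v \<in> S \<or> (\<exists>u\<in>S. (u, v) \<in> parcs G)}"

definition legal_moves :: "'a set \<Rightarrow> 'a set" where
  "legal_moves S = {v \<in> pverts G. card (dominated S) < card (dominated (insert v S))}"

text \<open>
  Number of moves still to be played under optimal play, when the vertices in \<open>S\<close> have been
  selected so far (by either player) and the indicated player is to move. While some vertex is
  undominated, selecting it is legal, so \<^const>\<open>Min\<close> and \<^const>\<open>Max\<close> are
  taken over finite nonempty sets (lemma \<open>legal_moves_nonempty\<close> below).
\<close>

function dominator_moves :: "'a set \<Rightarrow> nat" and staller_moves :: "'a set \<Rightarrow> nat" where
  "dominator_moves S =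
     (if dominated S = pverts G then 0
      else Suc (Min ((\<lambda>v. staller_moves (insert v S)) ` legal_moves S)))"
| "staller_moves S =
     (if dominated S = pverts G then 0
      else Suc (Max ((\<lambda>v. dominator_moves (insert v S)) ` legal_moves S)))"
  by pat_completeness auto

lemma dominated_subset: "dominated S \<subseteq> pverts G"
  by (auto simp: dominated_def)

lemma card_dominated_le: "card (dominated S) \<le> card (pverts G)"
  by (rule card_mono[OF pair_finite_verts dominated_subset])

termination
proof (relation "measure (\<lambda>x. card (pverts G) - card (dominated (case_sum id id x)))")
qed (use card_dominated_le in \<open>auto simp: legal_moves_def intro!: diff_less_mono2 intro: less_le_trans\<close>)

declare dominator_moves.simps [simp del] staller_moves.simps [simp del]

lemma finite_legal_moves: "finite (legal_moves S)"
  by (simp add: legal_moves_def)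

lemma legal_moves_nonempty:
  assumes "dominated S \<noteq> pverts G"
  shows "legal_moves S \<noteq> {}"
proof -
  obtain v where v: "v \<in> pverts G" "v \<notin> dominated S"
    using assms dominated_subset by blast
  have "dominated S \<subset> dominated (insert v S)"
    using v by (auto simp: dominated_def)
  then have "card (dominated S) < card (dominated (insert v S))"
    by (intro psubset_card_mono finite_subset[OF dominated_subset]) auto
  then show ?thesis
    using v by (auto simp: legal_moves_def)
qed

definition game_domination_number :: nat where
  "game_domination_number = dominator_moves {}"

end

end

theory Submission
  imports Defs
begin

text \<open>
  A position is the set of undominated (white) vertices; a dominated vertex is blue if it has a
  white neighbour. White vertices get weight 10 and blue ones a smaller weight depending on their
  number of white neighbours, so that the initial potential is \<open>10 n\<close>. Dominator maintains that
  17 times the number of remaining moves is at most the potential plus one; for this it suffices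
  that his move and the next one of Staller together lower the potential by 34.

  While some white vertex has three white neighbours, Dominator plays one of maximal white degree:
  he gains at least 25 and Staller at least 9. Afterwards he plays any move whose gain makes up for
  the cheapest replies it leaves. Inspecting positions without such a move shows that
  each white vertex lies in a 5-cycle component of white vertices, or in a 6-cycle component with
  two opposite blue vertices. Opening one of them gains 24 and allows a reply gaining only 9, but
  then Dominator wins back the tempo on the vertex left over (gain 17), after which every move of
  Staller gains at least 18: altogether 68 in four moves. If the game ends after three of these
  moves, only 50 is guaranteed, which is where the additive constant 1 is needed.
\<close>

text \<open>A slim position has white degrees at most 2. There a reply gains at least 8, and at
  least 9 if no leaf hangs on a vertex with two white neighbours. If no blue vertex has more than
  three white neighbours, it gains at least 10 when moreover no \<open>bwwb\<close> path exists, and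
  at least 12 when no leaf hangs on a vertex with a white neighbour. So a good move exists as soon
  as Dominator can gain 26, 25, 24 or 22, respectively. The structure of stuck positions comes from
  exhibiting moves that contradict these thresholds. The obstacle is that a move may create traps,
  whose bonus lowers its gain. Charging each new trap to one vertex makes a gain at least a sum of
  nonnegative local losses, so counting a few vertices near the move suffices. Both final components
  weigh 50 = 24 + 9 + 17, one less than three moves. On a single 5-cycle the game does last three
  moves, and 3 * 17 = 10 * 5 + 1, so the additive constant is attained.\<close>

lemma cap2D: "A \<inter> B = {a, b} \<Longrightarrow> y \<in> A \<Longrightarrow> y \<in> B \<Longrightarrow> y = a \<or> y = b"
  by (metis Int_iff insert_iff singletonD)

section \<open>The potential of a position\<close>

locale min_degree_two =
  fixes V :: "'a set" and N :: "'a \<Rightarrow> 'a set"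
  assumes finite_V: "finite V"
    and N_subset: "N x \<subseteq> V"
    and N_sym: "y \<in> N x \<Longrightarrow> x \<in> N y"
    and N_irrefl: "x \<notin> N x"
    and two_le_degree: "x \<in> V \<Longrightarrow> 2 \<le> card (N x)"
begin
definition wdeg :: "'a set \<Rightarrow> 'a \<Rightarrow> nat" where
  "wdeg U x = card (N x \<inter> U)"

definition play :: "'a set \<Rightarrow> 'a \<Rightarrow> 'a set" where
  "play U p = U - insert p (N p)"

definition legal :: "'a set \<Rightarrow> 'a \<Rightarrow> bool" where
  "legal U p \<longleftrightarrow> p \<in> V \<and> insert p (N p) \<inter> U \<noteq> {}"

lemma finite_N [simp]: "finite (N x)"
  using N_subset finite_V finite_subset by blast

lemma N_in_V: "y \<in> N x \<Longrightarrow> y \<in> V" "y \<in> N x \<Longrightarrow> x \<in> V"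
  using N_subset N_sym by blast+

lemma play_subset: "play U p \<subseteq> U"
  by (auto simp: play_def)

lemma wdeg_mono: "U' \<subseteq> U \<Longrightarrow> wdeg U' x \<le> wdeg U x"
  unfolding wdeg_def by (intro card_mono) auto

lemma wdeg_less: "U' \<subseteq> U \<Longrightarrow> v \<in> N x \<Longrightarrow> v \<in> U \<Longrightarrow> v \<notin> U' \<Longrightarrow> wdeg U' x < wdeg U x"
  unfolding wdeg_def by (intro psubset_card_mono) auto

lemma wdeg_pos: "v \<in> N x \<Longrightarrow> v \<in> U \<Longrightarrow> 1 \<le> wdeg U x"
  unfolding wdeg_def by (metis IntI One_nat_def Suc_leI card_gt_0_iff empty_iff finite_Int finite_N)

lemma wdeg_eq_0_iff: "wdeg U x = 0 \<longleftrightarrow> N x \<inter> U = {}"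
  unfolding wdeg_def by simp

lemma wdeg_eq_1_iff: "wdeg U x = 1 \<longleftrightarrow> (\<exists>v. N x \<inter> U = {v})"
  unfolding wdeg_def by (simp add: card_1_singleton_iff)

lemma wdeg_eq_1D: "wdeg U x = 1 \<Longrightarrow> v \<in> N x \<Longrightarrow> v \<in> U \<Longrightarrow> N x \<inter> U = {v}"
  unfolding wdeg_eq_1_iff by (metis IntI singletonD)

lemma wdeg_eq_2D:
  assumes "wdeg U x = 2" "v \<in> N x" "v \<in> U"
  obtains w where "N x \<inter> U = {v, w}" "v \<noteq> w"
proof -
  obtain a b where ab: "N x \<inter> U = {a, b}" "a \<noteq> b"
    using assms(1) unfolding wdeg_def card_2_iff by auto
  then have "v = a \<or> v = b" using assms(2,3) by auto
  then show ?thesis using that[of a] that[of b] ab by auto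
qed

lemma other_neighbour:
  assumes "v \<in> V"
  obtains x where "x \<in> N v" "x \<noteq> w"
proof -
  have "\<not> N v \<subseteq> {w}"
    using two_le_degree[OF assms] card_mono[of "{w}" "N v"] by auto
  then show ?thesis using that by blast
qed

text \<open>
  The weights make a white vertex with two white neighbours worth \<open>10 + 7 + 7 = 24\<close> to Dominator
  as soon as no white vertex has more than two white neighbours.
\<close>

definition bweight :: "nat \<Rightarrow> int" where
  "bweight k = (if k = 0 then 0 else if k = 1 then 3 else if k = 2 then 5 else 6)"

definition vweight :: "'a set \<Rightarrow> 'a \<Rightarrow> int" where
  "vweight U x = (if x \<in> U then 10 else bweight (wdeg U x))"

text \<open>
  A component consisting of a white vertex and two blue leaves has weight 16 but still costs a
  whole move, so it receives one extra unit.
\<close>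

definition trap :: "'a set \<Rightarrow> 'a set" where
  "trap U = {t \<in> U. card (N t) = 2 \<and> (\<forall>x\<in>N t. x \<notin> U \<and> wdeg U x = 1)}"

definition pot :: "'a set \<Rightarrow> int" where
  "pot U = (\<Sum>x\<in>V. vweight U x) + int (card (trap U))"

text \<open>
  A new trap raises the potential by one. This is charged to a neighbour that was not yet a blue
  leaf before the move; that vertex loses at least two units of weight. \<open>U\<close> is the position before
  the move.
\<close>

definition fresh :: "'a set \<Rightarrow> 'a \<Rightarrow> 'a" where
  "fresh U t = (SOME x. x \<in> N t \<and> (x \<in> U \<or> wdeg U x \<noteq> 1))"

definition loss :: "'a set \<Rightarrow> 'a set \<Rightarrow> 'a \<Rightarrow> int" where
  "loss U U' x = vweight U x - vweight U' x
     - (if \<exists>t\<in>trap U' - trap U. fresh U t = x then 1 else 0)"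

text \<open>The last claim makes the charging injective: a charged vertex has the trap as its only
  remaining white neighbour.\<close>

lemma fresh:
  assumes "U' \<subseteq> U" "t \<in> trap U' - trap U"
  shows "fresh U t \<in> N t" "fresh U t \<in> U \<or> 2 \<le> wdeg U (fresh U t)"
    "fresh U t \<notin> U'" "N (fresh U t) \<inter> U' = {t}"
proof -
  have "\<exists>x. x \<in> N t \<and> (x \<in> U \<or> wdeg U x \<noteq> 1)"
    using assms by (auto simp: trap_def)
  from someI_ex[OF this] have *: "fresh U t \<in> N t" "fresh U t \<in> U \<or> wdeg U (fresh U t) \<noteq> 1"
    unfolding fresh_def by auto
  have t: "t \<in> U'" "\<forall>x\<in>N t. x \<notin> U' \<and> wdeg U' x = 1"
    using assms(2) by (auto simp: trap_def)
  show "fresh U t \<in> N t" "fresh U t \<notin> U'" using * t by auto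
  show "N (fresh U t) \<inter> U' = {t}"
    by (rule wdeg_eq_1D) (use * t N_sym in auto)
  show "fresh U t \<in> U \<or> 2 \<le> wdeg U (fresh U t)"
    using * t(2) wdeg_mono[OF assms(1), of "fresh U t"] by fastforce
qed

text \<open>Since \<open>fresh U\<close> is injective on new traps, the charges inside
  \<open>loss\<close> add up to their number. Traps that disappear are counted separately; this is
  what later rewards finishing one.\<close>

lemma sum_loss_le:
  assumes "U \<subseteq> V" "U' \<subseteq> U"
  shows "(\<Sum>x\<in>V. loss U U' x) + int (card (trap U - trap U')) = pot U - pot U'"
proof -
  let ?T = "trap U' - trap U"
  have fin: "finite (trap U)" "finite (trap U')"
    using assms finite_V by (auto simp: trap_def intro: finite_subset)
  have inj: "inj_on (fresh U) ?T"
    by (rule inj_onI) (metis fresh(4)[OF assms(2)] singleton_inject)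
  have sub: "fresh U ` ?T \<subseteq> V"
    using fresh(1)[OF assms(2)] N_in_V by blast
  have "(\<Sum>x\<in>V. if \<exists>t\<in>?T. fresh U t = x then 1 else 0 :: int)
      = (\<Sum>x\<in>fresh U ` ?T. 1)"
    by (intro sum.mono_neutral_cong_right) (use finite_V sub in auto)
  also have "\<dots> = int (card ?T)"
    using card_image[OF inj] by simp
  finally have "(\<Sum>x\<in>V. loss U U' x) = (\<Sum>x\<in>V. vweight U x) - (\<Sum>x\<in>V. vweight U' x) - int (card ?T)"
    by (simp add: loss_def sum_subtractf)
  moreover have "int (card ?T) + int (card (trap U)) = int (card (trap U - trap U')) + int (card (trap U'))"
    using card_Int_Diff[OF fin(1), of "trap U'"] card_Int_Diff[OF fin(2), of "trap U"]
    by (simp add: Int_commute)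
  ultimately show ?thesis by (simp add: pot_def)
qed

section \<open>Losses of single vertices\<close>

lemma bweight_mono: "j \<le> k \<Longrightarrow> bweight j \<le> bweight k"
  by (auto simp: bweight_def)

lemma loss_fresh_leaf:
  assumes "U' \<subseteq> U" "t \<in> trap U' - trap U" "fresh U t = x"
  shows "x \<notin> U'" "N x \<inter> U' = {t}" "wdeg U' x = 1" "x \<in> U \<or> 2 \<le> wdeg U x"
  using fresh[OF assms(1,2)] assms(3) wdeg_eq_1_iff by auto

context
  fixes U U' :: "'a set"
  assumes sub: "U' \<subseteq> U"
begin

lemma loss_white_red:
  assumes "x \<in> U" "x \<notin> U'" "N x \<inter> U' = {}"
  shows "loss U U' x = 10"
proof -
  have "wdeg U' x = 0" using assms(3) by (simp add: wdeg_eq_0_iff)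
  then show ?thesis
    using assms loss_fresh_leaf[OF sub] unfolding loss_def vweight_def bweight_def by auto
qed

text \<open>The worst case is a leaf that carries a charge: 10 - 3 - 1.\<close>

lemma loss_white_ge_6:
  assumes "x \<in> U" "x \<notin> U'" "wdeg U' x \<le> 1"
  shows "6 \<le> loss U U' x"
  using assms unfolding loss_def vweight_def bweight_def by auto

lemma loss_white_ge_7:
  assumes "x \<in> U" "x \<notin> U'" "wdeg U' x \<le> 1" "\<And>t. N x \<inter> U' = {t} \<Longrightarrow> t \<notin> trap U'"
  shows "7 \<le> loss U U' x"
proof -
  have "\<not> (\<exists>t\<in>trap U' - trap U. fresh U t = x)"
    using assms(4) loss_fresh_leaf[OF sub] by blast
  then show ?thesis using assms(1-3) unfolding loss_def vweight_def bweight_def by auto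
qed

text \<open>A vertex that keeps two white neighbours is not a leaf and carries no charge: 10 -
  5.\<close>

lemma loss_white_ge_5:
  assumes "x \<in> U" "x \<notin> U'" "wdeg U' x \<le> 2"
  shows "5 \<le> loss U U' x"
proof (cases "wdeg U' x = 2")
  case True
  then have "\<not> (\<exists>t\<in>trap U' - trap U. fresh U t = x)"
    using loss_fresh_leaf(3)[OF sub] by fastforce
  then show ?thesis using True assms unfolding loss_def vweight_def bweight_def by auto
next
  case False
  then show ?thesis using loss_white_ge_6 assms by fastforce
qed

lemma loss_blue_red:
  assumes "x \<notin> U" "N x \<inter> U' = {}"
  shows "loss U U' x = bweight (wdeg U x)"
proof -
  have "wdeg U' x = 0" using assms(2) by (simp add: wdeg_eq_0_iff)
  then show ?thesis
    using assms sub loss_fresh_leaf[OF sub] unfolding loss_def vweight_def bweight_def by auto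
qed

text \<open>The weights 0, 3, 5, 6 increase strictly up to three white neighbours. A charge occurs
  only when the vertex becomes a leaf, and that drop is at least 2.\<close>

lemma loss_blue_ge_1:
  assumes "x \<notin> U" "wdeg U' x < wdeg U x" "wdeg U x \<le> 3"
  shows "1 \<le> loss U U' x"
proof (cases "wdeg U' x = 1")
  case True
  then show ?thesis using assms sub unfolding loss_def vweight_def bweight_def by auto
next
  case False
  then have "\<not> (\<exists>t\<in>trap U' - trap U. fresh U t = x)"
    using loss_fresh_leaf(3)[OF sub] by fastforce
  then show ?thesis using assms False sub unfolding loss_def vweight_def bweight_def by auto
qed

lemma loss_blue_new_leaf:
  assumes "x \<notin> U" "2 \<le> wdeg U x" "N x \<inter> U' = {t}" "t \<notin> trap U'"
  shows "2 \<le> loss U U' x"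
proof -
  have "\<not> (\<exists>t\<in>trap U' - trap U. fresh U t = x)"
  proof
    assume "\<exists>t\<in>trap U' - trap U. fresh U t = x"
    then obtain s where "s \<in> trap U'" "N x \<inter> U' = {s}"
      using loss_fresh_leaf(2)[OF sub, where x = x] by (metis DiffD1)
    then show False using assms(3,4) by simp
  qed
  moreover have "wdeg U' x = 1" using assms(3) wdeg_eq_1_iff by blast
  ultimately show ?thesis using assms sub unfolding loss_def vweight_def bweight_def by auto
qed

text \<open>A charged vertex weighed at least 5 before the move and weighs 3 after it. Nonnegativity
  is what allows a gain to be estimated from any selection of vertices.\<close>

lemma loss_nonneg: "0 \<le> loss U U' x"
proof (cases "\<exists>t\<in>trap U' - trap U. fresh U t = x")
  case True
  then obtain t where t: "t \<in> trap U' - trap U" "fresh U t = x" by (elim bexE)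
  have "x \<notin> U'" "wdeg U' x = 1" "x \<in> U \<or> 2 \<le> wdeg U x"
    using loss_fresh_leaf[OF sub t] by auto
  then show ?thesis unfolding loss_def vweight_def bweight_def by auto
next
  case False
  have "bweight (wdeg U' x) \<le> bweight (wdeg U x)" "bweight (wdeg U' x) \<le> 10"
    using bweight_mono[OF wdeg_mono[OF sub]] by (auto simp: bweight_def)
  then show ?thesis using False sub unfolding loss_def vweight_def by auto
qed

lemma sum_list_loss_le:
  assumes "U \<subseteq> V" "distinct xs" "set xs \<subseteq> V"
  shows "sum_list (map (loss U U') xs) + int (card (trap U - trap U')) \<le> pot U - pot U'"
proof -
  have "sum_list (map (loss U U') xs) = (\<Sum>x\<in>set xs. loss U U' x)"
    using assms(2) by (simp add: sum_list_distinct_conv_sum_set)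
  also have "\<dots> \<le> (\<Sum>x\<in>V. loss U U' x)"
    by (rule sum_mono2) (use assms finite_V loss_nonneg in auto)
  finally show ?thesis using sum_loss_le[OF assms(1) sub] by linarith
qed

end

definition gain :: "'a set \<Rightarrow> 'a \<Rightarrow> int" where
  "gain U p = pot U - pot (play U p)"

lemma gain_ge:
  assumes "U \<subseteq> V" "distinct xs" "set xs \<subseteq> V"
  shows "sum_list (map (loss U (play U p)) xs) \<le> gain U p"
  using sum_list_loss_le[OF play_subset assms, of p] unfolding gain_def by linarith

section \<open>Lower bounds for the replies of Staller\<close>

definition slim :: "'a set \<Rightarrow> bool" where
  "slim U \<longleftrightarrow> U \<subseteq> V \<and> (\<forall>u\<in>U. wdeg U u \<le> 2)"

text \<open>\<open>bweight\<close> is constant from 3 on, so only under this condition does a blue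
  vertex pay for every white neighbour that it loses.\<close>

definition blue3 :: "'a set \<Rightarrow> bool" where
  "blue3 U \<longleftrightarrow> (\<forall>x\<in>V - U. wdeg U x \<le> 3)"

definition leaf_at :: "'a set \<Rightarrow> 'a \<Rightarrow> 'a \<Rightarrow> bool" where
  "leaf_at U x v \<longleftrightarrow> x \<notin> U \<and> N x \<inter> U = {v}"

text \<open>
  Only a leaf whose white neighbour keeps a white neighbour allows Staller a cheap move: 8 if there
  are two such neighbours, 9 if the move leaves a trap behind (\<open>bwwb\<close>), and 10 otherwise.
\<close>

definition leaf_on_pair :: "'a set \<Rightarrow> bool" where
  "leaf_on_pair U \<longleftrightarrow> (\<exists>x v. leaf_at U x v \<and> N v \<inter> U \<noteq> {})"

definition leaf_on_middle :: "'a set \<Rightarrow> bool" where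
  "leaf_on_middle U \<longleftrightarrow> (\<exists>x v. leaf_at U x v \<and> 2 \<le> wdeg U v)"

text \<open>The letters are the colours along the path \<open>x\<close>, \<open>v\<close>,
  \<open>w\<close>, \<open>z\<close>. As \<open>v\<close> and \<open>w\<close> have no further
  neighbours, playing \<open>x\<close> turns \<open>w\<close> into a trap.\<close>

definition bwwb :: "'a set \<Rightarrow> 'a \<Rightarrow> 'a \<Rightarrow> 'a \<Rightarrow> 'a \<Rightarrow> bool" where
  "bwwb U x v w z \<longleftrightarrow> leaf_at U x v \<and> leaf_at U z w \<and> N v = {x, w} \<and> N w = {v, z}"

lemma slim_subset: "slim U \<Longrightarrow> U' \<subseteq> U \<Longrightarrow> slim U'"
  unfolding slim_def using wdeg_mono by (meson order_trans subset_iff)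

lemma slim_play: "slim U \<Longrightarrow> slim (play U p)"
  by (rule slim_subset[OF _ play_subset])

lemma leaf_atD:
  assumes "leaf_at U x v"
  shows "x \<notin> U" "v \<in> U" "v \<in> N x" "x \<in> N v" "wdeg U x = 1" "N x \<inter> U = {v}"
  using assms N_sym unfolding leaf_at_def wdeg_eq_1_iff by auto

lemma leaf_atI: "x \<notin> U \<Longrightarrow> wdeg U x = 1 \<Longrightarrow> v \<in> N x \<Longrightarrow> v \<in> U \<Longrightarrow> leaf_at U x v"
  unfolding leaf_at_def using wdeg_eq_1D by blast

lemma not_trap: "t \<in> U \<Longrightarrow> N t \<inter> U \<noteq> {} \<Longrightarrow> t \<notin> trap U"
  unfolding trap_def by auto

lemma play_cap_N [simp]: "N p \<inter> play U p = {}"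
  by (auto simp: play_def)

lemma mem_play: "x \<in> play U p \<longleftrightarrow> x \<in> U \<and> x \<noteq> p \<and> x \<notin> N p"
  by (auto simp: play_def)

lemma cap_play_empty_iff: "N v \<inter> play U p = {} \<longleftrightarrow> N v \<inter> U \<subseteq> insert p (N p)"
  by (auto simp: play_def)

abbreviation ploss :: "'a set \<Rightarrow> 'a \<Rightarrow> 'a \<Rightarrow> int" where
  "ploss U p \<equiv> loss U (play U p)"

lemma gain_ge_sum:
  assumes "U \<subseteq> V" "A \<subseteq> V"
  shows "(\<Sum>x\<in>A. ploss U p x) \<le> gain U p"
proof -
  obtain xs where "set xs = A" "distinct xs"
    using finite_distinct_list assms(2) finite_V finite_subset by metis
  then show ?thesis
    using gain_ge[OF assms(1), of xs p] assms(2) by (simp add: sum_list_distinct_conv_sum_set)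
qed

lemma ploss_self: "p \<in> U \<Longrightarrow> ploss U p p = 10"
  by (rule loss_white_red[OF play_subset]) (auto simp: play_def)

lemma ploss_white_red:
  assumes "v \<in> U" "v \<in> insert p (N p)" "N v \<inter> U \<subseteq> insert p (N p)"
  shows "ploss U p v = 10"
  using assms by (intro loss_white_red[OF play_subset]) (auto simp: play_def)

lemma wdeg_play_less: "v \<in> N p \<Longrightarrow> p \<in> U \<Longrightarrow> wdeg (play U p) v < wdeg U v"
  by (rule wdeg_less[of _ _ p]) (auto simp: play_def N_sym)

lemma wdeg_play_less': "v \<in> N x \<Longrightarrow> v \<in> U \<Longrightarrow> v \<in> insert p (N p) \<Longrightarrow> wdeg (play U p) x < wdeg U x"
  by (rule wdeg_less[of _ _ v]) (auto simp: play_def)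

lemma wdeg_play_le: "wdeg (play U p) v \<le> wdeg U v"
  by (rule wdeg_mono[OF play_subset])

lemma slimD: "slim U \<Longrightarrow> U \<subseteq> V" "slim U \<Longrightarrow> u \<in> U \<Longrightarrow> wdeg U u \<le> 2"
  by (auto simp: slim_def)

lemma ploss_white_nbr_ge_5:
  assumes "slim U" "v \<in> U" "v \<in> N p"
  shows "5 \<le> ploss U p v"
  using assms slimD(2)[OF assms(1,2)] wdeg_play_le[of U p v]
  by (intro loss_white_ge_5[OF play_subset]) (auto simp: play_def)

lemma ploss_white_nbr_ge_6:
  assumes "slim U" "v \<in> U" "v \<in> N p" "p \<in> U"
  shows "6 \<le> ploss U p v"
  using assms slimD(2)[OF assms(1,2)] wdeg_play_less[of v p U]
  by (intro loss_white_ge_6[OF play_subset]) (auto simp: play_def)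

lemma ploss_white_nbr_ge_6':
  assumes "v \<in> U" "v \<in> N p" "wdeg U v \<le> 1"
  shows "6 \<le> ploss U p v"
  using assms wdeg_play_le[of U p v]
  by (intro loss_white_ge_6[OF play_subset]) (auto simp: play_def)

lemma ploss_white_ge_7:
  assumes "v \<in> U" "v \<in> N p" "wdeg (play U p) v \<le> 1"
    and "\<And>t. t \<in> N v \<Longrightarrow> t \<in> U \<Longrightarrow> t \<noteq> p \<Longrightarrow> t \<notin> N p \<Longrightarrow> t \<notin> trap (play U p)"
  shows "7 \<le> ploss U p v"
proof (rule loss_white_ge_7[OF play_subset])
  fix t assume "N v \<inter> play U p = {t}"
  then have "t \<in> N v" "t \<in> U" "t \<noteq> p" "t \<notin> N p" by (auto simp: play_def)
  then show "t \<notin> trap (play U p)" by (rule assms(4))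
qed (use assms in \<open>auto simp: play_def\<close>)

lemma ploss_blue_red:
  assumes "x \<notin> U" "N x \<inter> U \<subseteq> insert p (N p)"
  shows "ploss U p x = bweight (wdeg U x)"
  using assms by (intro loss_blue_red[OF play_subset]) (auto simp: play_def)

lemma ploss_blue_self: "p \<notin> U \<Longrightarrow> ploss U p p = bweight (wdeg U p)"
  by (rule ploss_blue_red) auto

lemma blue3D: "blue3 U \<Longrightarrow> x \<notin> U \<Longrightarrow> x \<in> V \<Longrightarrow> wdeg U x \<le> 3"
  by (auto simp: blue3_def)

lemma ploss_blue_ge_1:
  assumes "blue3 U" "x \<notin> U" "v \<in> N x" "v \<in> U" "v \<in> insert p (N p)"
  shows "1 \<le> ploss U p x"
  using assms blue3D[OF assms(1,2) N_in_V(2)[OF assms(3)]] wdeg_play_less'[OF assms(3-5)]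
  by (intro loss_blue_ge_1[OF play_subset]) auto

lemma blue3_play: "blue3 U \<Longrightarrow> slim U \<Longrightarrow> blue3 (play U p)"
  unfolding blue3_def
proof
  fix x assume *: "\<forall>x\<in>V - U. wdeg U x \<le> 3" "slim U" "x \<in> V - play U p"
  have "wdeg U x \<le> 3" using * slimD(2)[OF *(2), of x] by (cases "x \<in> U") auto
  then show "wdeg (play U p) x \<le> 3" using wdeg_play_le[of U p x] by linarith
qed

lemma bweight_simps [simp]: "bweight 0 = 0" "bweight (Suc 0) = 3" "bweight 2 = 5"
  "3 \<le> k \<Longrightarrow> bweight k = 6"
  by (auto simp: bweight_def)

lemma ploss_leaf: "leaf_at U x v \<Longrightarrow> v \<in> insert p (N p) \<Longrightarrow> ploss U p x = 3"
  using leaf_atD[of U x v] by (subst ploss_blue_red) auto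

lemma gain_white_ge: "U \<subseteq> V \<Longrightarrow> q \<in> U \<Longrightarrow> 10 \<le> gain U q"
  using gain_ge[of U "[q]" q] ploss_self[of q U] by auto

lemma two_white_nbrs:
  assumes "2 \<le> wdeg U q"
  obtains v w where "v \<in> N q" "v \<in> U" "w \<in> N q" "w \<in> U" "v \<noteq> w"
proof -
  obtain A where A: "A \<subseteq> N q \<inter> U" "card A = 2"
    using obtain_subset_with_card_n[of 2 "N q \<inter> U"] assms unfolding wdeg_def by metis
  then obtain v w where vw: "A = {v, w}" "v \<noteq> w" unfolding card_2_iff by auto
  show ?thesis by (rule that[of v w]) (use A vw in auto)
qed

lemma legal_cases:
  assumes "legal U q"
  obtains (white) "q \<in> U" | (leaf) v where "leaf_at U q v"
    | (blue) "q \<notin> U" "2 \<le> wdeg U q"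
proof (cases "q \<in> U")
  case False
  then obtain v where v: "v \<in> N q" "v \<in> U" using assms by (auto simp: legal_def)
  then show ?thesis
    using wdeg_pos[OF v] leaf_atI[OF False _ v] blue leaf False
    by (cases "wdeg U q = 1") auto
qed

lemma gain_blue_ge_15:
  assumes "slim U" "q \<notin> U" "2 \<le> wdeg U q"
  shows "15 \<le> gain U q"
proof -
  obtain v w where vw: "v \<in> N q" "v \<in> U" "w \<in> N q" "w \<in> U" "v \<noteq> w"
    using two_white_nbrs[OF assms(3)] .
  have "5 \<le> ploss U q q"
    using assms bweight_mono[of 2 "wdeg U q"] by (simp add: ploss_blue_self)
  moreover have "5 \<le> ploss U q v" "5 \<le> ploss U q w"
    using ploss_white_nbr_ge_5[OF assms(1)] vw by auto
  moreover have "sum_list (map (ploss U q) [q, v, w]) \<le> gain U q"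
    by (rule gain_ge[OF slimD(1)[OF assms(1)]]) (use vw assms(2) N_in_V in auto)
  ultimately show ?thesis by simp
qed

lemma gain_leaf_eq:
  assumes "U \<subseteq> V" "leaf_at U q v"
  shows "3 + ploss U q v \<le> gain U q"
proof -
  note lf = leaf_atD[OF assms(2)]
  have "sum_list (map (ploss U q) [q, v]) \<le> gain U q"
    by (rule gain_ge[OF assms(1)]) (use lf N_in_V in auto)
  then show ?thesis using ploss_leaf[OF assms(2), of q] lf by simp
qed

text \<open>The cheapest move is a leaf: 3 for the leaf and 5 for its white neighbour when that
  keeps two white neighbours.\<close>

lemma gain_ge_8:
  assumes "slim U" "legal U q"
  shows "8 \<le> gain U q"
  using assms(2)
proof (cases rule: legal_cases)
  case white
  then show ?thesis using gain_white_ge[OF slimD(1)[OF assms(1)] white] by simp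
next
  case (leaf v)
  then show ?thesis
    using gain_leaf_eq[OF slimD(1)[OF assms(1)] leaf]
      ploss_white_nbr_ge_5[OF assms(1) leaf_atD(2,3)[OF leaf]] by simp
next
  case blue
  then show ?thesis using gain_blue_ge_15[OF assms(1) blue] by simp
qed

lemma gain_ge_9:
  assumes "slim U" "legal U q" "\<not> leaf_on_middle U"
  shows "9 \<le> gain U q"
  using assms(2)
proof (cases rule: legal_cases)
  case white
  then show ?thesis using gain_white_ge[OF slimD(1)[OF assms(1)] white] by simp
next
  case (leaf v)
  then have "wdeg U v \<le> 1" using assms(3) unfolding leaf_on_middle_def by fastforce
  then show ?thesis
    using gain_leaf_eq[OF slimD(1)[OF assms(1)] leaf]
      ploss_white_nbr_ge_6'[OF leaf_atD(2,3)[OF leaf]] by simp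
next
  case blue
  then show ?thesis using gain_blue_ge_15[OF assms(1) blue] by simp
qed

text \<open>A gain below 10 means a leaf move, 3, on a vertex \<open>v\<close> that loses less than
  7. Then \<open>v\<close> is charged for a new trap \<open>w\<close>, and the trap condition
  determines the surroundings of \<open>w\<close>.\<close>

lemma gain_less_10:
  assumes "slim U" "blue3 U" "legal U q" "\<not> leaf_on_middle U" "gain U q < 10"
  shows "\<exists>v w z. bwwb U q v w z"
  using assms(3)
proof (cases rule: legal_cases)
  case white
  then show ?thesis using gain_white_ge[OF slimD(1)[OF assms(1)] white] assms(5) by simp
next
  case blue
  then show ?thesis using gain_blue_ge_15[OF assms(1) blue] assms(5) by simp
next
  case (leaf v)
  note lf = leaf_atD[OF leaf]
  have UV: "U \<subseteq> V" using slimD(1)[OF assms(1)] .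
  have v1: "wdeg U v \<le> 1" using leaf assms(4) unfolding leaf_on_middle_def by fastforce
  have lv: "ploss U q v < 7"
    using gain_leaf_eq[OF UV leaf] assms(5) by linarith
  have w1': "wdeg (play U q) v \<le> 1" using v1 wdeg_play_le[of U q v] by linarith
  obtain w where w: "w \<in> N v" "w \<in> U" "w \<noteq> q" "w \<notin> N q" "w \<in> trap (play U q)"
    using ploss_white_ge_7[OF lf(2,3) w1'] lv by force
  have Nv_U: "N v \<inter> U = {w}"
    using v1 wdeg_pos[OF w(1,2)] wdeg_eq_1D[OF _ w(1,2)] by simp
  \<comment> \<open>A third neighbour of \<open>v\<close> would be blue and lose at least 1, giving
    3 + 6 + 1.\<close>
  have Nv: "N v = {q, w}"
  proof (rule ccontr)
    assume "N v \<noteq> {q, w}"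
    then obtain y where y: "y \<in> N v" "y \<noteq> q" "y \<noteq> w" using lf(4) w(1) by auto
    then have yU: "y \<notin> U" using Nv_U by auto
    have "1 \<le> ploss U q y"
      by (rule ploss_blue_ge_1[OF assms(2) yU, of v]) (use y N_sym lf in auto)
    moreover have "6 \<le> ploss U q v"
      by (rule ploss_white_nbr_ge_6') (use lf v1 in auto)
    moreover have "sum_list (map (ploss U q) [q, v, y]) \<le> gain U q"
      by (rule gain_ge[OF UV]) (use y yU lf N_in_V in auto)
    ultimately show False using ploss_leaf[OF leaf, of q] lf(3) assms(5) by simp
  qed
  have wt: "card (N w) = 2" "\<And>x. x \<in> N w \<Longrightarrow> x \<notin> play U q \<and> wdeg (play U q) x = 1"
    using w(5) unfolding trap_def by auto
  have "v \<in> N w" using w(1) N_sym by auto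
  then obtain z where z: "N w = {v, z}" "v \<noteq> z"
    using wt(1) unfolding card_2_iff by (metis doubleton_eq_iff insert_iff singletonD)
  have zw: "z \<in> N w" "w \<in> N z" using z N_sym by auto
  have zq: "z \<noteq> q" using w(4) zw by auto
  have zU: "z \<notin> U"
    using wt(2)[OF zw(1)] zq z(2) lf(6) by (auto simp: mem_play)
  \<comment> \<open>The move dominates only \<open>v\<close>, which is not adjacent to
    \<open>z\<close>; hence \<open>z\<close>, a leaf after the move, was already one before
    it.\<close>
  have "N z \<inter> U \<subseteq> N z \<inter> play U q"
  proof -
    have "v \<notin> N z" using Nv z zq w(2) zU N_sym by blast
    then have "y \<noteq> q \<and> y \<notin> N q" if "y \<in> N z" "y \<in> U" for y
      using that lf(1,6) by (metis IntI singletonD)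
    then show ?thesis by (auto simp: mem_play)
  qed
  then have "N z \<inter> U = N z \<inter> play U q" using play_subset by blast
  then have "wdeg U z = 1" using wt(2)[OF zw(1)] by (simp add: wdeg_def)
  then have "leaf_at U z w" by (rule leaf_atI[OF zU _ zw(2) w(2)])
  then show ?thesis using leaf Nv z unfolding bwwb_def by blast
qed

text \<open>A leaf gains 3 + 10, since its white neighbour has no white neighbour. A white vertex
  gains 10 and at least 1 from each of two neighbours, which is where minimum degree two
  enters.\<close>

lemma gain_ge_12:
  assumes "slim U" "blue3 U" "legal U q" "\<not> leaf_on_pair U"
  shows "12 \<le> gain U q"
  using assms(3)
proof (cases rule: legal_cases)
  case blue
  then show ?thesis using gain_blue_ge_15[OF assms(1) blue] by simp
next
  case (leaf v)
  note lf = leaf_atD[OF leaf]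
  have "N v \<inter> U = {}" using leaf assms(4) unfolding leaf_on_pair_def by auto
  then have "ploss U q v = 10" using lf by (intro ploss_white_red) auto
  then show ?thesis using gain_leaf_eq[OF slimD(1)[OF assms(1)] leaf] by linarith
next
  case white
  have UV: "U \<subseteq> V" using slimD(1)[OF assms(1)] .
  have qV: "q \<in> V" using white UV by auto
  obtain x where x: "x \<in> N q" using other_neighbour[OF qV] .
  obtain y where y: "y \<in> N q" "y \<noteq> x" using other_neighbour[OF qV] .
  have neq: "x \<noteq> q" "y \<noteq> q" using x y N_irrefl by auto
  have *: "1 \<le> ploss U q a" if "a \<in> N q" for a
  proof (cases "a \<in> U")
    case True
    then show ?thesis using ploss_white_nbr_ge_5[OF assms(1) True that] by simp
  next
    case False
    show ?thesis by (rule ploss_blue_ge_1[OF assms(2) False, of q]) (use that N_sym white in auto)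
  qed
  have "sum_list (map (ploss U q) [q, x, y]) \<le> gain U q"
    by (rule gain_ge[OF UV]) (use x y neq N_in_V in auto)
  then show ?thesis using *[OF x] *[OF y(1)] ploss_self[OF white] by simp
qed

section \<open>Moves that suffice for Dominator, and the positions that allow a reply below
  10\<close>

definition low :: "'a set \<Rightarrow> bool" where
  "low U \<longleftrightarrow> leaf_on_middle U \<or> (\<exists>x v w z. bwwb U x v w z)"

text \<open>The bound 17 is for a move that ends the game at once, the bound 34 for a move together
  with the reply.\<close>

definition good :: "'a set \<Rightarrow> 'a \<Rightarrow> bool" where
  "good U p \<longleftrightarrow> legal U p \<and> 17 \<le> gain U p
     \<and> (\<forall>q. legal (play U p) q \<longrightarrow> 34 \<le> gain U p + gain (play U p) q)"

text \<open>The intermediate bound 50 = 3 * 17 - 1 is for games that end with the third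
  move.\<close>

definition good_twice :: "'a set \<Rightarrow> 'a \<Rightarrow> bool" where
  "good_twice U p \<longleftrightarrow> legal U p \<and> 17 \<le> gain U p
     \<and> (\<forall>q. legal (play U p) q \<longrightarrow> 34 \<le> gain U p + gain (play U p) q
       \<or> (\<exists>r. legal (play (play U p) q) r
            \<and> 50 \<le> gain U p + gain (play U p) q + gain (play (play U p) q) r
            \<and> (\<forall>s. legal (play (play (play U p) q) r) s \<longrightarrow>
                 68 \<le> gain U p + gain (play U p) q + gain (play (play U p) q) r
                   + gain (play (play (play U p) q) r) s)))"

text \<open>In the last case \<open>x\<close> drops from at least 5 to 3 and carries no charge,
  because \<open>v\<close> keeps a white neighbour and so is no trap. A dangerous new leaf is thus
  either a vertex just dominated or worth two further units to Dominator.\<close>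

lemma leaf_on_pair_after:
  assumes "leaf_at (play U p) x v" "N v \<inter> play U p \<noteq> {}"
  obtains "leaf_at U x v" | "x \<in> U" "x \<in> insert p (N p)"
    | "x \<notin> U" "2 \<le> wdeg U x" "2 \<le> ploss U p x" "x \<noteq> p"
proof (cases "x \<in> U")
  case True
  then show ?thesis using that(2) leaf_atD(1)[OF assms(1)] by (auto simp: mem_play)
next
  case False
  note lf = leaf_atD[OF assms(1)]
  have v: "v \<in> U" using lf(2) play_subset by blast
  have le: "wdeg (play U p) x \<le> wdeg U x" by (rule wdeg_play_le)
  have xp: "x \<noteq> p" using lf(3,2) by (auto simp: mem_play)
  show ?thesis
  proof (cases "wdeg U x = 1")
    case True
    then show ?thesis using that(1) leaf_atI[OF False _ lf(3) v] by blast
  next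
    case False
    then have "2 \<le> wdeg U x" using le lf(5) by linarith
    moreover have "2 \<le> ploss U p x"
      by (rule loss_blue_new_leaf[OF play_subset \<open>x \<notin> U\<close> \<open>2 \<le> wdeg U x\<close> lf(6)])
        (rule not_trap[OF lf(2) assms(2)])
    ultimately show ?thesis using that(3) \<open>x \<notin> U\<close> xp by blast
  qed
qed

text \<open>Without a charge the loss would be at least 10 - 3.\<close>

lemma ploss_white_less_7:
  assumes "v \<in> U" "v \<in> N p" "wdeg (play U p) v \<le> 1" "ploss U p v < 7"
  obtains t where "t \<in> trap (play U p)" "fresh U t = v" "N v \<inter> play U p = {t}"
proof -
  have "\<exists>t\<in>trap (play U p) - trap U. fresh U t = v"
  proof (rule ccontr)
    assume "\<not> ?thesis"
    then have "7 \<le> ploss U p v"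
      using assms(1-3) unfolding loss_def vweight_def bweight_def by (auto simp: mem_play)
    then show False using assms(4) by simp
  qed
  then obtain t where t: "t \<in> trap (play U p) - trap U" "fresh U t = v" by (elim bexE)
  show ?thesis
    by (rule that[of t]) (use t loss_fresh_leaf(2)[OF play_subset t] in auto)
qed

lemma legal_white: "U \<subseteq> V \<Longrightarrow> p \<in> U \<Longrightarrow> legal U p"
  by (auto simp: legal_def)

lemma legal_nbr: "v \<in> N p \<Longrightarrow> v \<in> U \<Longrightarrow> legal U p"
  using N_in_V by (auto simp: legal_def)

lemma trapD:
  assumes "t \<in> trap U"
  shows "t \<in> U" "N t \<inter> U = {}" "card (N t) = 2" "\<And>x. x \<in> N t \<Longrightarrow> wdeg U x = 1"
  using assms unfolding trap_def by auto

lemma wdeg2_nbrs: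
  assumes "wdeg U v \<le> 2" "a \<in> N v" "a \<in> U" "b \<in> N v" "b \<in> U" "a \<noteq> b"
  shows "N v \<inter> U = {a, b}"
proof -
  have "{a, b} \<subseteq> N v \<inter> U" using assms by auto
  moreover have "card (N v \<inter> U) \<le> card {a, b}" using assms(1,6) by (simp add: wdeg_def)
  ultimately show ?thesis by (metis card_seteq finite_Int finite_N)
qed

lemma bwwb_commute: "bwwb U x v w z \<Longrightarrow> bwwb U z w v x"
  unfolding bwwb_def by auto

text \<open>The white components are then isolated vertices all of whose neighbours are blue leaves,
  single edges without leaves, and cycles without blue neighbours.\<close>

definition tidy :: "'a set \<Rightarrow> bool" where
  "tidy U \<longleftrightarrow> slim U \<and> \<not> leaf_on_pair U
     \<and> (\<forall>u\<in>U. \<forall>x\<in>N u. x \<notin> U \<longrightarrow> wdeg U u \<le> 1 \<and> (wdeg U u = 0 \<longrightarrow> wdeg U x = 1))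
     \<and> (\<forall>u\<in>U. wdeg U u = 1 \<longrightarrow> (\<forall>w\<in>N u. w \<in> U \<longrightarrow> wdeg U w = 1))"

lemma tidyD:
  assumes "tidy U"
  shows "slim U" "\<not> leaf_on_pair U"
    "\<And>u x. u \<in> U \<Longrightarrow> x \<in> N u \<Longrightarrow> x \<notin> U \<Longrightarrow> wdeg U u \<le> 1"
    "\<And>u x. u \<in> U \<Longrightarrow> x \<in> N u \<Longrightarrow> wdeg U u = 0 \<Longrightarrow> wdeg U x = 1"
    "\<And>u w. u \<in> U \<Longrightarrow> w \<in> N u \<Longrightarrow> w \<in> U \<Longrightarrow> wdeg U u = 1 \<Longrightarrow> wdeg U w = 1"
proof -
  show "wdeg U x = 1" if "u \<in> U" "x \<in> N u" "wdeg U u = 0" for u x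
  proof -
    have "x \<notin> U" using that(2,3) wdeg_eq_0_iff[of U u] by auto
    then show ?thesis using assms that unfolding tidy_def by blast
  qed
qed (use assms in \<open>unfold tidy_def, blast+\<close>)

text \<open>With two neighbours \<open>t\<close> is a trap, and its bonus completes 10 + 3 + 3 to
  17; with at least three neighbours the gain is at least 10 + 9.\<close>

lemma single_gain:
  assumes "U \<subseteq> V" "t \<in> U" "N t \<inter> U = {}" "\<And>x. x \<in> N t \<Longrightarrow> wdeg U x = 1" "q \<in> insert t (N t)"
  shows "17 \<le> gain U q" "play U q = U - {t}"
proof -
  show play: "play U q = U - {t}"
  proof (cases "q = t")
    case True
    then show ?thesis using assms(3) by (auto simp: play_def)
  next
    case False
    then have q: "q \<in> N t" "q \<notin> U" using assms(3,5) by auto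
    then have "N q \<inter> U = {t}" using wdeg_eq_1D assms N_sym by metis
    then show ?thesis using q(2) by (auto simp: play_def)
  qed
  let ?U = "U - {t}"
  have sub: "?U \<subseteq> U" by auto
  have tV: "t \<in> V" using assms(1,2) by auto
  obtain xs where xs: "set xs = N t" "distinct xs" using finite_distinct_list finite_N by metis
  have len: "length xs = card (N t)" using distinct_card[OF xs(2)] xs(1) by simp
  have "loss U ?U x = 3" if "x \<in> N t" for x
  proof -
    have "N x \<inter> U = {t}" using wdeg_eq_1D assms(2,4) that N_sym by metis
    then show ?thesis
      using loss_blue_red[OF sub, of x] that assms(3) assms(4)[OF that] by auto
  qed
  then have "map (loss U ?U) xs = map (\<lambda>_. 3) xs" using xs(1) by auto
  then have "sum_list (map (loss U ?U) xs) = 3 * int (card (N t))"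
    by (simp only: sum_list_triv len)
  moreover have "loss U ?U t = 10"
    by (rule loss_white_red[OF sub]) (use assms in auto)
  moreover have "sum_list (map (loss U ?U) (t # xs)) + int (card (trap U - trap ?U)) \<le> pot U - pot ?U"
    by (rule sum_list_loss_le[OF sub assms(1)]) (use xs N_irrefl tV N_in_V in auto)
  ultimately have *: "10 + 3 * int (card (N t)) + int (card (trap U - trap ?U)) \<le> gain U q"
    unfolding gain_def play by simp
  show "17 \<le> gain U q"
  proof (cases "card (N t) = 2")
    case True
    then have "t \<in> trap U - trap ?U" using assms(2,3,4) by (auto simp: trap_def)
    moreover have "finite (trap U)"
      by (rule finite_subset[of _ V]) (use assms(1) finite_V in \<open>auto simp: trap_def\<close>)
    ultimately have "1 \<le> card (trap U - trap ?U)"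
      by (metis One_nat_def Suc_leI card_gt_0_iff empty_iff finite_Diff)
    then show ?thesis using * True by simp
  next
    case False
    then have "3 \<le> card (N t)" using two_le_degree[OF tV] by simp
    then show ?thesis using * by simp
  qed
qed

text \<open>Clearing an isolated white vertex gains 17. A white vertex gains 10 + 10 in a pair and
  10 + 6 + 6 in a cycle. A blue vertex with several white neighbours gains 5 + 6 + 6, and one more
  unit has to be found if no white vertex is isolated.\<close>

lemma tidy_gain:
  assumes "tidy U" "legal U q"
  shows "17 \<le> gain U q" "(\<And>u. u \<in> U \<Longrightarrow> wdeg U u \<noteq> 0) \<Longrightarrow> 18 \<le> gain U q"
proof -
  note t = tidyD[OF assms(1)]
  have UV: "U \<subseteq> V" using slimD(1)[OF t(1)] .
  have "17 \<le> gain U q \<and> ((\<forall>u\<in>U. wdeg U u \<noteq> 0) \<longrightarrow> 18 \<le> gain U q)"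
    using assms(2)
  proof (cases rule: legal_cases)
    case (leaf v)
    note lf = leaf_atD[OF leaf]
    have N0: "N v \<inter> U = {}" using t(2) leaf unfolding leaf_on_pair_def by auto
    then have w0: "wdeg U v = 0" by (simp add: wdeg_eq_0_iff)
    have "17 \<le> gain U q"
      by (rule single_gain(1)[OF UV lf(2) N0]) (use t(4)[OF lf(2) _ w0] lf(4) in auto)
    then show ?thesis using w0 lf(2) by auto
  next
    case white
    have self: "ploss U q q = 10" by (rule ploss_self[OF white])
    consider "wdeg U q = 0" | "wdeg U q = 1" | "wdeg U q = 2"
      using slimD(2)[OF t(1) white] by linarith
    then show ?thesis
    proof cases
      case 1
      then have "17 \<le> gain U q"
        using single_gain(1)[OF UV white _ t(4)[OF white _ 1]] wdeg_eq_0_iff[of U q] by auto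
      then show ?thesis using 1 white by auto
    next
      case 2
      then obtain w where w: "N q \<inter> U = {w}" using wdeg_eq_1_iff by auto
      then have wm: "w \<in> N q" "w \<in> U" "q \<in> N w" using N_sym by auto
      then have "N w \<inter> U = {q}" using wdeg_eq_1D t(5)[OF white _ _ 2] white by metis
      then have "ploss U q w = 10" using wm by (intro ploss_white_red) auto
      moreover have "sum_list (map (ploss U q) [q, w]) \<le> gain U q"
        by (rule gain_ge[OF UV]) (use wm white UV N_irrefl in auto)
      ultimately show ?thesis using self by simp
    next
      case 3
      then obtain a b where ab: "a \<in> N q" "a \<in> U" "b \<in> N q" "b \<in> U" "a \<noteq> b"
        using two_white_nbrs[of U q] by auto
      then have "6 \<le> ploss U q a" "6 \<le> ploss U q b"
        using ploss_white_nbr_ge_6[OF t(1)] white by auto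
      moreover have "sum_list (map (ploss U q) [q, a, b]) \<le> gain U q"
        by (rule gain_ge[OF UV]) (use ab white UV N_irrefl in auto)
      ultimately show ?thesis using self by simp
    qed
  next
    case blue
    obtain v w where vw: "v \<in> N q" "v \<in> U" "w \<in> N q" "w \<in> U" "v \<noteq> w"
      using two_white_nbrs[OF blue(2)] .
    have qV: "q \<in> V" using vw(1) N_in_V by auto
    have le1: "wdeg U v \<le> 1" "wdeg U w \<le> 1"
      using t(3)[OF vw(2) N_sym[OF vw(1)] blue(1)] t(3)[OF vw(4) N_sym[OF vw(3)] blue(1)] by auto
    have q5: "5 \<le> ploss U q q"
      using bweight_mono[OF blue(2)] blue(1) by (simp add: ploss_blue_self)
    have v6: "6 \<le> ploss U q v" and w6: "6 \<le> ploss U q w"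
      using ploss_white_nbr_ge_6' vw le1 by auto
    have s3: "sum_list (map (ploss U q) [q, v, w]) \<le> gain U q"
      by (rule gain_ge[OF UV]) (use vw blue UV qV in auto)
    have "18 \<le> gain U q" if ns: "\<forall>u\<in>U. wdeg U u \<noteq> 0"
    proof (cases "ploss U q v < 7")
      case False
      then show ?thesis using s3 q5 w6 by simp
    next
      case True
      have "wdeg (play U q) v \<le> 1" using le1(1) wdeg_play_le[of U q v] by simp
      then obtain s where s: "s \<in> trap (play U q)" "N v \<inter> play U q = {s}"
        using ploss_white_less_7[OF vw(2,1) _ True] by metis
      have sm: "s \<in> U" "s \<noteq> q" "s \<notin> N q" "s \<in> N v" "v \<in> N s"
        using trapD(1)[OF s(1)] s(2) N_sym by (auto simp: mem_play)
      have v1: "wdeg U v = 1" using bspec[OF ns vw(2)] le1(1) by linarith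
      then have "wdeg U s = 1" using t(5)[OF vw(2) sm(4,1)] by simp
      then have Ns: "N s \<inter> U = {v}" by (rule wdeg_eq_1D[OF _ sm(5) vw(2)])
      have sV: "s \<in> V" using sm(1) UV by auto
      \<comment> \<open>\<open>v\<close> lost only 6 because its partner \<open>s\<close> became a
        trap. The other neighbour \<open>y\<close> of \<open>s\<close> was not a leaf before, since
        no leaf hangs on a pair; becoming one costs it at least 1 even if it is charged.\<close>
      obtain y where y: "y \<in> N s" "y \<noteq> v" using other_neighbour[OF sV] .
      have yU: "y \<notin> U" using y Ns by auto
      have y1: "wdeg (play U q) y = 1" using trapD(4)[OF s(1) y(1)] .
      have yq: "y \<noteq> q" using y(1) sm(3) N_sym by auto
      have "wdeg U y \<noteq> 1"
      proof
        assume "wdeg U y = 1"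
        then have "leaf_at U y s" using leaf_atI[OF yU _ N_sym[OF y(1)] sm(1)] by simp
        then show False using t(2) Ns unfolding leaf_on_pair_def by auto
      qed
      then have "2 \<le> wdeg U y" using y1 wdeg_play_le[of U q y] by simp
      then have "1 \<le> ploss U q y"
        using y1 yU unfolding loss_def vweight_def bweight_def by (auto simp: mem_play)
      moreover have "sum_list (map (ploss U q) [q, v, w, y]) \<le> gain U q"
        by (rule gain_ge[OF UV]) (use vw blue UV qV y yU yq N_in_V in auto)
      ultimately show ?thesis using q5 v6 w6 by simp
    qed
    then show ?thesis using s3 q5 v6 w6 by simp
  qed
  then show "17 \<le> gain U q" "(\<And>u. u \<in> U \<Longrightarrow> wdeg U u \<noteq> 0) \<Longrightarrow> 18 \<le> gain U q" by auto
qed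

text \<open>The part \<open>R\<close> can be cleared without changing the colours and white degrees
  around the rest of \<open>U\<close>.\<close>

definition separated :: "'a set \<Rightarrow> 'a set \<Rightarrow> bool" where
  "separated U R \<longleftrightarrow> R \<subseteq> U \<and> (\<forall>y. insert y (N y) \<inter> R \<noteq> {} \<longrightarrow> insert y (N y) \<inter> U \<subseteq> R)"

lemma separated_wdeg:
  assumes "separated U R" "u \<in> U - R" "y \<in> insert u (N u)"
  shows "wdeg (U - R) y = wdeg U y" "y \<notin> U - R \<Longrightarrow> y \<notin> U"
proof -
  have "u \<in> insert y (N y) \<inter> U" using assms(2,3) N_sym by auto
  then have "insert y (N y) \<inter> R = {}" using assms(1,2) unfolding separated_def by blast
  then have "N y \<inter> (U - R) = N y \<inter> U" "y \<notin> R" by auto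
  then show "wdeg (U - R) y = wdeg U y" "y \<notin> U - R \<Longrightarrow> y \<notin> U" by (auto simp: wdeg_def)
qed

lemma tidy_separated:
  assumes "tidy U" "separated U R"
  shows "tidy (U - R)"
proof -
  note t = tidyD[OF assms(1)]
  note s = separated_wdeg[OF assms(2)]
  have "\<not> leaf_on_pair (U - R)"
  proof
    assume "leaf_on_pair (U - R)"
    then obtain x v where xv: "leaf_at (U - R) x v" "N v \<inter> (U - R) \<noteq> {}"
      unfolding leaf_on_pair_def by auto
    note lf = leaf_atD[OF xv(1)]
    have "x \<notin> U" "wdeg U x = 1" using s[OF lf(2), of x] lf by auto
    then have "leaf_at U x v" using leaf_atI lf(2,3) by blast
    then show False using t(2) xv(2) unfolding leaf_on_pair_def by auto
  qed
  moreover have "slim (U - R)" using slim_subset[OF t(1)] by auto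
  moreover have "wdeg (U - R) u \<le> 1 \<and> (wdeg (U - R) u = 0 \<longrightarrow> wdeg (U - R) x = 1)"
    if "u \<in> U - R" "x \<in> N u" "x \<notin> U - R" for u x
    using s[OF that(1), of u] s[OF that(1), of x] that t(3)[of u x] t(4)[of u x] by auto
  moreover have "wdeg (U - R) w = 1"
    if "u \<in> U - R" "wdeg (U - R) u = 1" "w \<in> N u" "w \<in> U - R" for u w
    using s[OF that(1), of u] s[OF that(1), of w] that t(5)[of u w] by auto
  ultimately show ?thesis unfolding tidy_def by auto
qed

section \<open>Large white degrees\<close>

text \<open>Before a position is slim, a dominated vertex may keep three white neighbours and lose
  only 4. With weight 5 for a leaf, a reply at a leaf still gains 9. The dearer leaves also cover
  the bonus of the traps, see \<open>pot_le_pot0\<close>.\<close>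

definition bweight0 :: "nat \<Rightarrow> int" where
  "bweight0 k = (if k = 0 then 0 else if k \<le> 2 then 5 else 6)"

definition vweight0 :: "'a set \<Rightarrow> 'a \<Rightarrow> int" where
  "vweight0 U x = (if x \<in> U then 10 else bweight0 (wdeg U x))"

definition pot0 :: "'a set \<Rightarrow> int" where
  "pot0 U = (\<Sum>x\<in>V. vweight0 U x)"

lemma vweight0_mono: "U' \<subseteq> U \<Longrightarrow> vweight0 U' x \<le> vweight0 U x"
  using wdeg_mono[of U' U x] unfolding vweight0_def bweight0_def by auto

lemma pot0_drop:
  assumes "A \<subseteq> V"
  shows "(\<Sum>x\<in>A. vweight0 U x - vweight0 (play U p) x) \<le> pot0 U - pot0 (play U p)"
  unfolding pot0_def sum_subtractf[symmetric]
  by (rule sum_mono2) (use assms finite_V vweight0_mono[OF play_subset] in auto)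

lemma pot0_reply:
  assumes "legal U q"
  shows "9 \<le> pot0 U - pot0 (play U q)"
proof -
  obtain v where v: "v \<in> insert q (N q)" "v \<in> U" using assms by (auto simp: legal_def)
  have qV: "q \<in> V" and vV: "v \<in> V" using assms v N_in_V by (auto simp: legal_def)
  show ?thesis
  proof (cases "q \<in> U")
    case True
    have "wdeg (play U q) q = 0" by (simp add: wdeg_eq_0_iff)
    then have "vweight0 U q - vweight0 (play U q) q = 10"
      using True by (simp add: vweight0_def bweight0_def mem_play)
    then show ?thesis using pot0_drop[of "{q}" U q] qV by simp
  next
    case False
    then have vq: "v \<in> N q" "v \<noteq> q" using v by auto
    have "wdeg (play U q) q = 0" by (simp add: wdeg_eq_0_iff)
    then have "5 \<le> vweight0 U q - vweight0 (play U q) q"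
      using False wdeg_pos[OF vq(1) v(2)] by (simp add: vweight0_def bweight0_def mem_play)
    moreover have "4 \<le> vweight0 U v - vweight0 (play U q) v"
      using v(2) vq by (simp add: vweight0_def bweight0_def mem_play)
    ultimately show ?thesis using pot0_drop[of "{q, v}" U q] qV vV vq by simp
  qed
qed

text \<open>Let \<open>p\<close> have maximal white degree. Its white neighbours lose
  \<open>p\<close>, so their white degrees fall below the maximum. If this is 3, they keep weight at
  most 5 and the gain is 10 + 3 * 5; otherwise it is at least 10 + 4 * 4.\<close>

lemma pot0_opening:
  assumes "U \<subseteq> V" "u \<in> U" "3 \<le> wdeg U u"
  obtains p where "p \<in> U" "25 \<le> pot0 U - pot0 (play U p)"
proof -
  have finU: "finite U" using assms(1) finite_V finite_subset by auto
  have "Max (wdeg U ` U) \<in> wdeg U ` U"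
    by (rule Max_in) (use finU assms(2) in auto)
  then obtain p where p: "p \<in> U" "Max (wdeg U ` U) = wdeg U p" by auto
  have p_max: "wdeg U x \<le> wdeg U p" if "x \<in> U" for x
    using Max_ge[of "wdeg U ` U" "wdeg U x"] that finU p(2) by simp
  let ?U = "play U p" and ?A = "N p \<inter> U"
  have cA: "card ?A = wdeg U p" by (simp add: wdeg_def)
  have p3: "3 \<le> wdeg U p" using p_max[OF assms(2)] assms(3) by simp
  have "wdeg ?U p = 0" by (simp add: wdeg_eq_0_iff)
  then have self: "vweight0 U p - vweight0 ?U p = 10"
    using p(1) by (simp add: vweight0_def bweight0_def mem_play)
  have nbr: "(if wdeg U p = 3 then 5 else 4) \<le> vweight0 U x - vweight0 ?U x" if x: "x \<in> ?A" for x
  proof -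
    have "wdeg ?U x < wdeg U p"
      using wdeg_play_less[of x p U] p(1) p_max[of x] x by simp
    then show ?thesis using x by (auto simp: vweight0_def bweight0_def mem_play)
  qed
  have "15 \<le> int (card ?A) * (if wdeg U p = 3 then 5 else 4)"
    using p3 cA by auto
  also have "\<dots> \<le> (\<Sum>x\<in>?A. vweight0 U x - vweight0 ?U x)"
    by (rule sum_bounded_below[OF nbr])
  finally have "25 \<le> (\<Sum>x\<in>insert p ?A. vweight0 U x - vweight0 ?U x)"
    using self N_irrefl by simp
  also have "\<dots> \<le> pot0 U - pot0 ?U"
    by (rule pot0_drop) (use assms(1) p(1) in auto)
  finally show ?thesis using that p(1) by blast
qed

text \<open>Any neighbour of a trap is a leaf that weighs 5 instead of 3 and belongs to no other
  trap; the surplus pays for the bonus.\<close>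

lemma pot_le_pot0:
  assumes "U \<subseteq> V"
  shows "pot U \<le> pot0 U"
proof -
  have "\<exists>x. x \<in> N t" if "t \<in> trap U" for t
    using trapD(3)[OF that] by (metis card.empty ex_in_conv zero_neq_numeral)
  then obtain l where l: "\<And>t. t \<in> trap U \<Longrightarrow> l t \<in> N t" by metis
  have leaf: "l t \<notin> U" "wdeg U (l t) = 1" "N (l t) \<inter> U = {t}" if "t \<in> trap U" for t
  proof -
    show "l t \<notin> U" "wdeg U (l t) = 1" using l[OF that] trapD(2,4)[OF that] by auto
    then show "N (l t) \<inter> U = {t}"
      using wdeg_eq_1D N_sym[OF l[OF that]] trapD(1)[OF that] by simp
  qed
  have inj: "inj_on l (trap U)"
    by (rule inj_onI) (metis leaf(3) singleton_inject)
  have "int (card (trap U)) = (\<Sum>x\<in>l ` trap U. 1)"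
    using card_image[OF inj] by simp
  also have "\<dots> \<le> (\<Sum>x\<in>l ` trap U. vweight0 U x - vweight U x)"
    by (rule sum_mono) (use leaf in \<open>auto simp: vweight0_def vweight_def bweight0_def bweight_def\<close>)
  also have "\<dots> \<le> (\<Sum>x\<in>V. vweight0 U x - vweight U x)"
    by (rule sum_mono2) (use finite_V l N_in_V in
        \<open>auto simp: vweight0_def vweight_def bweight0_def bweight_def\<close>)
  finally show ?thesis by (simp add: pot_def pot0_def sum_subtractf)
qed

lemma pot_nonneg: "0 \<le> pot U"
  unfolding pot_def vweight_def bweight_def by (intro add_nonneg_nonneg sum_nonneg) auto

lemma pot0_nonneg: "0 \<le> pot0 U"
  unfolding pot0_def vweight0_def bweight0_def by (intro sum_nonneg) auto

lemma pot0_V: "pot0 V = 10 * int (card V)"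
  unfolding pot0_def vweight0_def by simp

end

section \<open>Positions without a good move\<close>

locale stuck = min_degree_two +
  fixes U
  assumes slim_U: "slim U"
    and no_good: "\<not> good U p"
begin
lemmas U_subset = slimD(1)[OF slim_U]
lemmas wdeg_le_2 = slimD(2)[OF slim_U]

section \<open>Thresholds for the gain of a move, and the first forbidden leaves\<close>

lemma stuck_reply:
  assumes "legal U p" "g \<le> gain U p" "17 \<le> g"
    "\<And>q. legal (play U p) q \<Longrightarrow> 34 - g \<le> gain (play U p) q"
  shows False
proof -
  have "34 \<le> gain U p + gain (play U p) q" if "legal (play U p) q" for q
    using assms(4)[OF that] assms(2) by linarith
  then show False using no_good assms(1-3) unfolding good_def by fastforce
qed

lemma no_26: "legal U p \<Longrightarrow> gain U p < 26"
  using stuck_reply[of p 26] gain_ge_8[OF slim_play[OF slim_U]] by force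

lemma blue3_U: "blue3 U"
  unfolding blue3_def
proof (rule ballI, rule ccontr)
  fix x assume x: "x \<in> V - U" "\<not> wdeg U x \<le> 3"
  then have "4 \<le> card (N x \<inter> U)" by (simp add: wdeg_def)
  then obtain A where A: "A \<subseteq> N x \<inter> U" "card A = 4"
    using obtain_subset_with_card_n by metis
  have fin: "finite A" by (rule finite_subset[OF A(1)]) simp
  \<comment> \<open>Four white neighbours lose at least 5 each; with 6 for \<open>x\<close> itself
    this reaches 26.\<close>
  have "20 \<le> (\<Sum>v\<in>A. ploss U x v)"
    using sum_bounded_below[of A "5::int" "ploss U x"] ploss_white_nbr_ge_5[OF slim_U, of _ x] A
    by auto
  moreover have "ploss U x x = 6"
    using x by (simp add: ploss_blue_self)
  moreover have "(\<Sum>v\<in>insert x A. ploss U x v) \<le> gain U x"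
    by (rule gain_ge_sum[OF U_subset]) (use A U_subset x in auto)
  moreover have "(\<Sum>v\<in>insert x A. ploss U x v) = ploss U x x + (\<Sum>v\<in>A. ploss U x v)"
    by (rule sum.insert) (use A fin N_irrefl in auto)
  ultimately have "26 \<le> gain U x" by linarith
  moreover have "A \<noteq> {}" using A(2) by auto
  then obtain v where "v \<in> N x" "v \<in> U" using A(1) by auto
  then have "legal U x" by (rule legal_nbr)
  ultimately show False using no_26 by fastforce
qed

lemma after_25:
  assumes "legal U p" "25 \<le> gain U p"
  shows "leaf_on_middle (play U p)"
proof (rule ccontr)
  assume "\<not> leaf_on_middle (play U p)"
  then show False
    using stuck_reply[OF assms] gain_ge_9[OF slim_play[OF slim_U]] by simp
qed

lemma after_24:
  assumes "legal U p" "24 \<le> gain U p"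
  shows "low (play U p)"
proof (rule ccontr)
  assume *: "\<not> low (play U p)"
  have "34 - 24 \<le> gain (play U p) q" if "legal (play U p) q" for q
    using gain_less_10[OF slim_play[OF slim_U] blue3_play[OF blue3_U slim_U] that] *
    unfolding low_def by force
  then show False using stuck_reply[OF assms] by simp
qed

lemma after_22:
  assumes "legal U p" "22 \<le> gain U p"
  shows "leaf_on_pair (play U p)"
proof (rule ccontr)
  assume "\<not> leaf_on_pair (play U p)"
  then show False
    using stuck_reply[OF assms] gain_ge_12[OF slim_play[OF slim_U] blue3_play[OF blue3_U slim_U]]
    by simp
qed

text \<open>
  Playing the middle vertex \<open>v\<close> itself falls short only if it creates two traps; then playing its
  neighbour \<open>w1\<close> instead also finishes off the vertex \<open>t1\<close> that would become a trap.
\<close>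

lemma no_leaf_on_middle: "\<not> leaf_on_middle U"
proof
  assume "leaf_on_middle U"
  then obtain x v where leaf: "leaf_at U x v" and "2 \<le> wdeg U v"
    unfolding leaf_on_middle_def by auto
  note lf = leaf_atD[OF leaf]
  have v2: "wdeg U v = 2" using wdeg_le_2[OF lf(2)] \<open>2 \<le> wdeg U v\<close> by simp
  obtain w1 w2 where "w1 \<in> N v" "w1 \<in> U" "w2 \<in> N v" "w2 \<in> U" "w1 \<noteq> w2"
    using two_white_nbrs \<open>2 \<le> wdeg U v\<close> by metis
  note w = this
  have Nv: "N v \<inter> U = {w1, w2}" using wdeg2_nbrs w v2 by simp
  have lv: "legal U v" using legal_white[OF U_subset lf(2)] .
  have neq: "v \<noteq> w1" "v \<noteq> w2" using w N_irrefl by auto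
  have "sum_list (map (ploss U v) [v, x, w1, w2]) \<le> gain U v"
    by (rule gain_ge[OF U_subset]) (use lf w neq N_in_V in auto)
  moreover have "ploss U v v = 10" "ploss U v x = 3"
    using ploss_self[OF lf(2)] ploss_leaf[OF leaf] by auto
  moreover have ge6: "6 \<le> ploss U v w1" "6 \<le> ploss U v w2"
    using ploss_white_nbr_ge_6[OF slim_U] w lf(2) by auto
  ultimately have lt7: "ploss U v w1 < 7" "ploss U v w2 < 7"
    using no_26[OF lv] by simp_all
  have le1: "wdeg (play U v) w1 \<le> 1" "wdeg (play U v) w2 \<le> 1"
    using wdeg_play_less[OF w(1) lf(2)] wdeg_play_less[OF w(3) lf(2)] wdeg_le_2[OF w(2)]
      wdeg_le_2[OF w(4)] by simp_all
  obtain t1 where t1: "t1 \<in> trap (play U v)" "fresh U t1 = w1" "N w1 \<inter> play U v = {t1}"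
    using ploss_white_less_7[OF w(2,1) le1(1) lt7(1)] .
  obtain t2 where t2: "t2 \<in> trap (play U v)" "fresh U t2 = w2" "N w2 \<inter> play U v = {t2}"
    using ploss_white_less_7[OF w(4,3) le1(2) lt7(2)] .
  have "t1 \<noteq> t2" using t1(2) t2(2) w(5) by auto
  then have "w2 \<notin> N t1"
    using t2(3) trapD(1)[OF t1(1)] N_sym by blast
  moreover have "N t1 \<inter> U \<subseteq> insert v (N v)"
    using trapD(2)[OF t1(1)] by (simp add: cap_play_empty_iff)
  moreover have t1m: "t1 \<in> U" "t1 \<noteq> v" "t1 \<notin> N v" "t1 \<in> N w1"
    using trapD(1)[OF t1(1)] t1(3) by (auto simp: mem_play)
  moreover have "v \<notin> N t1" using t1m(3) N_sym by auto
  ultimately have "N t1 \<inter> U \<subseteq> {w1}" using Nv by auto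
  then have "ploss U w1 t1 = 10"
    using t1m by (intro ploss_white_red) auto
  moreover have "ploss U w1 w1 = 10" using ploss_self[OF w(2)] .
  moreover have "6 \<le> ploss U w1 v"
    by (rule ploss_white_nbr_ge_6[OF slim_U lf(2) N_sym[OF w(1)] w(2)])
  moreover have "sum_list (map (ploss U w1) [w1, t1, v]) \<le> gain U w1"
    by (rule gain_ge[OF U_subset]) (use lf w neq t1m U_subset N_irrefl in auto)
  ultimately show False using no_26[OF legal_white[OF U_subset w(2)]] by simp
qed

text \<open>Playing \<open>v\<close> clears the whole path: 10 + 10 + 3 + 3 = 26.\<close>

lemma no_bwwb: "\<not> bwwb U x v w z"
proof
  assume *: "bwwb U x v w z"
  then have leaf: "leaf_at U x v" "leaf_at U z w" and Nv: "N v = {x, w}" "N w = {v, z}"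
    unfolding bwwb_def by auto
  note lf = leaf_atD[OF leaf(1)] and lg = leaf_atD[OF leaf(2)]
  have "v \<noteq> w" using Nv N_irrefl by auto
  then have "x \<noteq> z" using lf(6) lg(6) by auto
  have "sum_list (map (ploss U v) [v, w, x, z]) \<le> gain U v"
    by (rule gain_ge[OF U_subset]) (use lf lg \<open>v \<noteq> w\<close> \<open>x \<noteq> z\<close> U_subset N_in_V in auto)
  moreover have "ploss U v v = 10" "ploss U v w = 10"
    using ploss_self[OF lf(2)] ploss_white_red[of w U v] lg Nv by auto
  moreover have "ploss U v x = 3" "ploss U v z = 3"
    using ploss_leaf[OF leaf(1)] ploss_leaf[OF leaf(2), of v] Nv by auto
  ultimately show False using no_26[OF legal_white[OF U_subset lf(2)]] by simp
qed

text \<open>The position before the move is not low by \<open>no_leaf_on_middle\<close> and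
  \<open>no_bwwb\<close>, so at least one leaf responsible for the low position after it is
  new.\<close>

lemma low_after:
  assumes "low (play U p)"
  obtains x v where "leaf_at (play U p) x v" "N v \<inter> play U p \<noteq> {}" "x \<in> U" "x \<in> insert p (N p)"
    | x v where "leaf_at (play U p) x v" "N v \<inter> play U p \<noteq> {}"
        "x \<notin> U" "x \<noteq> p" "2 \<le> wdeg U x" "2 \<le> ploss U p x"
proof -
  let ?U = "play U p"
  have "\<exists>x v. leaf_at ?U x v \<and> N v \<inter> ?U \<noteq> {} \<and> \<not> leaf_at U x v"
    using assms unfolding low_def
  proof
    assume "leaf_on_middle ?U"
    then obtain x v where xv: "leaf_at ?U x v" "2 \<le> wdeg ?U v"
      unfolding leaf_on_middle_def by auto
    have "\<not> leaf_at U x v"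
      using no_leaf_on_middle xv(2) wdeg_play_le[of U p v] unfolding leaf_on_middle_def
      by (meson order_trans)
    moreover have "N v \<inter> ?U \<noteq> {}" using xv(2) unfolding wdeg_def by auto
    ultimately show ?thesis using xv(1) by blast
  next
    assume "\<exists>x v w z. bwwb ?U x v w z"
    then obtain x v w z where b: "bwwb ?U x v w z" by blast
    then have l: "leaf_at ?U x v" "leaf_at ?U z w" "N v = {x, w}" "N w = {v, z}"
      unfolding bwwb_def by auto
    have "N v \<inter> ?U \<noteq> {}" "N w \<inter> ?U \<noteq> {}" using l leaf_atD(2) by fastforce+
    moreover have "\<not> (leaf_at U x v \<and> leaf_at U z w)"
      using l no_bwwb[of x v w z] unfolding bwwb_def by auto
    ultimately show ?thesis using l(1,2) by blast
  qed
  then obtain x v where xv: "leaf_at ?U x v" "N v \<inter> ?U \<noteq> {}" "\<not> leaf_at U x v" by blast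
  from xv(1,2) show ?thesis
    by (cases rule: leaf_on_pair_after) (use xv that in auto)
qed

section \<open>White vertices with two white neighbours\<close>

lemma wdeg_nbr_of_middle:
  assumes "a \<in> U" "b \<in> U" "a \<in> N b" "wdeg U b = 2"
  shows "wdeg U a = 2"
proof (rule ccontr)
  assume "wdeg U a \<noteq> 2"
  have ba: "b \<in> N a" using N_sym assms(3) by auto
  have "wdeg U a = 1"
    using wdeg_pos[OF ba assms(2)] wdeg_le_2[OF assms(1)] \<open>wdeg U a \<noteq> 2\<close> by simp
  then have Na: "N a \<inter> U = {b}" by (rule wdeg_eq_1D[OF _ ba assms(2)])
  obtain d where d: "N b \<inter> U = {a, d}" "a \<noteq> d"
    using wdeg_eq_2D[OF assms(4,3,1)] .
  then have dm: "d \<in> N b" "d \<in> U" by auto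
  \<comment> \<open>The end \<open>a\<close> has no white neighbour besides \<open>b\<close>, so
    \<open>b\<close> gains 10 + 10 + 6. Hence a white component with a middle vertex has no ends: it
    is a cycle.\<close>
  have "sum_list (map (ploss U b) [b, a, d]) \<le> gain U b"
    by (rule gain_ge[OF U_subset]) (use assms d dm N_irrefl U_subset in auto)
  moreover have "ploss U b a = 10"
    by (rule ploss_white_red) (use assms Na in auto)
  moreover have "6 \<le> ploss U b d"
    by (rule ploss_white_nbr_ge_6[OF slim_U]) (use dm assms in auto)
  ultimately show False
    using no_26[OF legal_white[OF U_subset assms(2)]] ploss_self[OF assms(2)] by simp
qed

lemma no_white_triangle:
  assumes "b \<in> U" "c \<in> U" "d \<in> U" "b \<in> N c" "d \<in> N c"
  shows "d \<notin> N b"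
proof
  assume db: "d \<in> N b"
  have *: "c \<in> N b" "c \<in> N d" "b \<in> N d" using N_sym assms db by auto
  have neq: "b \<noteq> c" "c \<noteq> d" "b \<noteq> d" using assms db N_irrefl by auto
  have "N b \<inter> U = {c, d}" "N d \<inter> U = {c, b}"
    using wdeg2_nbrs[OF wdeg_le_2] assms db * neq by auto
  then have "ploss U c b = 10" "ploss U c d = 10"
    using assms by (auto intro!: ploss_white_red)
  moreover have "sum_list (map (ploss U c) [c, b, d]) \<le> gain U c"
    by (rule gain_ge[OF U_subset]) (use assms neq U_subset in auto)
  ultimately show False
    using no_26[OF legal_white[OF U_subset assms(2)]] ploss_self[OF assms(2)] by simp
qed

text \<open>The vertices \<open>a\<close>, \<open>b\<close>, \<open>c\<close>, \<open>d\<close>,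
  \<open>e\<close> are consecutive on a white cycle; \<open>a = e\<close> is possible and means
  length 4.\<close>

lemma middle_path:
  assumes "c \<in> U" "wdeg U c = 2"
  obtains a b d e where "N c \<inter> U = {b, d}" "N b \<inter> U = {c, a}" "N d \<inter> U = {c, e}"
    "b \<noteq> d" "a \<noteq> c" "e \<noteq> c" "a \<noteq> d" "e \<noteq> b" "a \<notin> N c" "e \<notin> N c"
    "wdeg U a = 2" "wdeg U b = 2" "wdeg U d = 2" "wdeg U e = 2"
    "a \<in> U" "b \<in> U" "d \<in> U" "e \<in> U"
proof -
  obtain b d where bd: "b \<in> N c" "b \<in> U" "d \<in> N c" "d \<in> U" "b \<noteq> d"
    using two_white_nbrs[of U c] assms(2) by auto
  have Nc: "N c \<inter> U = {b, d}" using wdeg2_nbrs[OF wdeg_le_2[OF assms(1)]] bd by auto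
  have w2: "wdeg U b = 2" "wdeg U d = 2" using wdeg_nbr_of_middle assms bd by auto
  have cb: "c \<in> N b" "c \<in> N d" using bd N_sym by auto
  obtain a where a: "N b \<inter> U = {c, a}" "c \<noteq> a" using wdeg_eq_2D[OF w2(1) cb(1) assms(1)] .
  obtain e where e: "N d \<inter> U = {c, e}" "c \<noteq> e" using wdeg_eq_2D[OF w2(2) cb(2) assms(1)] .
  have am: "a \<in> N b" "a \<in> U" "e \<in> N d" "e \<in> U" using a e by auto
  have "a \<notin> N c" using no_white_triangle[of b c a] am assms bd by auto
  moreover have "e \<notin> N c" using no_white_triangle[of d c e] am assms bd by auto
  moreover have "wdeg U a = 2" "wdeg U e = 2" using wdeg_nbr_of_middle am bd w2 by auto
  ultimately show ?thesis
    using that[of b d a e] Nc a e bd w2 am by auto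
qed

text \<open>
  If \<open>c\<close> had a blue neighbour, playing the opposite vertex \<open>a\<close> of the 4-cycle would not turn \<open>c\<close>
  into a trap.
\<close>

lemma middle_cycle4_nbrs:
  assumes "c \<in> U" "a \<in> U" "a \<noteq> c" "N c \<inter> U = {b, d}" "N b \<inter> U = {c, a}" "N d \<inter> U = {c, a}"
    and "b \<noteq> d"
  shows "N c \<subseteq> U"
proof (rule ccontr)
  assume "\<not> N c \<subseteq> U"
  then have "N c \<noteq> {b, d}" using assms(4) by auto
  moreover have "{b, d} \<subseteq> N c" using assms(4) by auto
  ultimately have "card {b, d} < card (N c)" by (intro psubset_card_mono) auto
  then have c3: "c \<notin> trap (play U a)" using assms(7) by (auto simp: trap_def)
  have m: "b \<in> U" "d \<in> U" "b \<in> N a" "d \<in> N a" "b \<in> N c" "d \<in> N c"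
    using assms N_sym by blast+
  have Na: "N a \<inter> U = {b, d}"
    by (rule wdeg2_nbrs[OF wdeg_le_2]) (use m assms in auto)
  have ne: "a \<noteq> b" "a \<noteq> d" "c \<noteq> b" "c \<noteq> d" using m N_irrefl by auto
  have cut: "U \<inter> insert a (N a) = {a, b, d}" using Na assms(2) by auto
  have le1: "wdeg (play U a) b \<le> 1" "wdeg (play U a) d \<le> 1"
    using wdeg_play_less[of b a U] wdeg_play_less[of d a U] m assms(2) wdeg_le_2[OF m(1)]
      wdeg_le_2[OF m(2)] by simp_all
  have tc: "t = c" if "t \<in> N b \<or> t \<in> N d" "t \<in> U" "t \<noteq> a" for t
    using that cap2D[OF assms(5)] cap2D[OF assms(6)] by metis
  have "7 \<le> ploss U a b"
    by (rule ploss_white_ge_7[OF m(1,3) le1(1)]) (use tc c3 in blast)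
  moreover have "7 \<le> ploss U a d"
    by (rule ploss_white_ge_7[OF m(2,4) le1(2)]) (use tc c3 in blast)
  moreover have "ploss U a a = 10" by (rule ploss_self[OF assms(2)])
  moreover note base = calculation
  have "sum_list (map (ploss U a) [a, b, d]) \<le> gain U a"
    by (rule gain_ge[OF U_subset]) (use m ne assms U_subset in auto)
  ultimately have "24 \<le> gain U a" by simp
  moreover have la: "legal U a" by (rule legal_white[OF U_subset assms(2)])
  ultimately have "low (play U a)" using after_24 by blast
  then show False
  proof (cases rule: low_after)
    case (1 x v)
    then have "x \<in> {a, b, d}" using cut by auto
    moreover have "v \<in> U" "v \<noteq> a" "v \<noteq> b" "v \<noteq> d" "v \<in> N x"
      using leaf_atD(2,3)[OF 1(1)] m by (auto simp: mem_play)
    \<comment> \<open>The only vertex that can get a new leaf from the move is \<open>c\<close>, and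
      \<open>c\<close> has just lost both white neighbours.\<close>
    ultimately have "v = c" using Na assms(5,6) by auto
    then show False using 1(2) assms(4) m by (auto simp: play_def)
  next
    case (2 x v)
    have "x \<in> V" using leaf_atD(3)[OF 2(1)] N_in_V by auto
    then have "sum_list (map (ploss U a) [a, b, d, x]) \<le> gain U a"
      by (intro gain_ge[OF U_subset]) (use m ne assms 2 U_subset in auto)
    then show False using 2 base no_26[OF la] by simp
  qed
qed

section \<open>Opening a white cycle of length at least five\<close>

context
  fixes a b c d e
  assumes path: "N c \<inter> U = {b, d}" "N b \<inter> U = {c, a}" "N d \<inter> U = {c, e}"
    "b \<noteq> d" "a \<noteq> c" "e \<noteq> c" "a \<noteq> d" "e \<noteq> b" "a \<notin> N c" "e \<notin> N c"
    "wdeg U a = 2" "wdeg U b = 2" "wdeg U d = 2" "wdeg U e = 2"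
    "a \<in> U" "b \<in> U" "d \<in> U" "e \<in> U" "c \<in> U" "a \<noteq> e"
begin

lemma path_nbrs: "b \<in> N c" "d \<in> N c" "c \<in> N b" "c \<in> N d" "a \<in> N b" "e \<in> N d" "b \<in> N a" "d \<in> N e"
  using path(1-3) N_sym by blast+

lemma path_cut: "U \<inter> insert c (N c) = {b, c, d}"
  using path(1,19) by auto

text \<open>Only \<open>b\<close>, \<open>c\<close>, \<open>d\<close> are dominated by the move, and
  the second white neighbours of \<open>a\<close> and \<open>e\<close> are none of these.\<close>

lemma path_not_trap: "a \<notin> trap (play U c)" "e \<notin> trap (play U c)"
proof -
  obtain f where f: "N a \<inter> U = {b, f}" "b \<noteq> f" using wdeg_eq_2D[OF path(11) path_nbrs(7) path(16)] .
  obtain g where g: "N e \<inter> U = {d, g}" "d \<noteq> g" using wdeg_eq_2D[OF path(14) path_nbrs(8) path(17)] .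
  have "f \<in> U" "f \<in> N a" "a \<in> N f" "g \<in> U" "g \<in> N e" "e \<in> N g" using f g N_sym by blast+
  moreover have "f \<noteq> c" "g \<noteq> c" using calculation path(9,10) by auto
  moreover have "f \<noteq> d" "g \<noteq> b" using calculation path(2,3,5,6,15,18,20) by auto
  moreover have "f \<notin> N c" "g \<notin> N c"
    using calculation f(2) g(2) cap2D[OF path(1)] by metis+
  ultimately have "f \<in> N a \<inter> play U c" "g \<in> N e \<inter> play U c"
    by (simp_all add: mem_play)
  then show "a \<notin> trap (play U c)" "e \<notin> trap (play U c)" using trapD(2) by blast+
qed

lemma path_ploss: "ploss U c c = 10" "7 \<le> ploss U c b" "7 \<le> ploss U c d"
proof -
  show "ploss U c c = 10" by (rule ploss_self[OF path(19)])
  have le1: "wdeg (play U c) b \<le> 1" "wdeg (play U c) d \<le> 1"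
    using wdeg_play_less[of b c U] wdeg_play_less[of d c U] path path_nbrs by simp_all
  have ta: "t = a" if "t \<in> N b" "t \<in> U" "t \<noteq> c" for t using that cap2D[OF path(2)] by metis
  have te: "t = e" if "t \<in> N d" "t \<in> U" "t \<noteq> c" for t using that cap2D[OF path(3)] by metis
  show "7 \<le> ploss U c b"
    by (rule ploss_white_ge_7[OF path(16) path_nbrs(1) le1(1)]) (use ta path_not_trap in blast)
  show "7 \<le> ploss U c d"
    by (rule ploss_white_ge_7[OF path(17) path_nbrs(2) le1(2)]) (use te path_not_trap in blast)
qed

lemma path_legal: "legal U c"
  by (rule legal_white[OF U_subset path(19)])

lemma path_gain: "24 \<le> gain U c"
proof -
  have "sum_list (map (ploss U c) [c, b, d]) \<le> gain U c"
    by (rule gain_ge[OF U_subset]) (use path path_nbrs N_irrefl U_subset in auto)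
  then show ?thesis using path_ploss by simp
qed

lemma path_no_fresh_blue: "x \<in> V \<Longrightarrow> x \<notin> U \<Longrightarrow> ploss U c x < 2"
proof (rule ccontr)
  assume x: "x \<in> V" "x \<notin> U" "\<not> ploss U c x < 2"
  have "sum_list (map (ploss U c) [c, b, d, x]) \<le> gain U c"
    by (rule gain_ge[OF U_subset]) (use x path path_nbrs N_irrefl U_subset in auto)
  then show False using x path_ploss no_26[OF path_legal] by simp
qed

lemma path_leaf_after:
  assumes "leaf_at (play U c) x v" "N v \<inter> play U c \<noteq> {}"
  shows "leaf_at U x v \<or> x = b \<and> v = a \<or> x = d \<and> v = e"
  using assms
proof (cases rule: leaf_on_pair_after)
  case 2
  then have "x \<in> {b, c, d}" using path_cut by auto
  moreover have "v \<in> U" "v \<noteq> c" "v \<notin> N c" "v \<in> N x"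
    using leaf_atD(2,3)[OF assms(1)] by (auto simp: mem_play)
  ultimately show ?thesis using path(1-3) by auto
next
  case 3
  then show ?thesis using path_no_fresh_blue[of x] leaf_atD(3)[OF assms(1)] N_in_V by force
qed auto

text \<open>New dangerous leaves can only be \<open>b\<close> at \<open>a\<close> and
  \<open>d\<close> at \<open>e\<close>, but the move takes a white neighbour from both
  \<open>a\<close> and \<open>e\<close>.\<close>

lemma path_no_middle_after: "\<not> leaf_on_middle (play U c)"
proof
  assume "leaf_on_middle (play U c)"
  then obtain x v where xv: "leaf_at (play U c) x v" "2 \<le> wdeg (play U c) v"
    unfolding leaf_on_middle_def by auto
  have "N v \<inter> play U c \<noteq> {}" using xv(2) unfolding wdeg_def by auto
  moreover have "\<not> leaf_at U x v"
    using no_leaf_on_middle xv(2) wdeg_play_le[of U c v] unfolding leaf_on_middle_def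
    by (meson order_trans)
  ultimately have v: "v = a \<or> v = e" using path_leaf_after[OF xv(1)] by auto
  have "wdeg (play U c) a < 2" "wdeg (play U c) e < 2"
    using wdeg_play_less'[of b a U c] wdeg_play_less'[of d e U c] path path_nbrs by auto
  then show False using v xv(2) by auto
qed

text \<open>On a white cycle \<open>w\<close> also has two white neighbours, so \<open>z\<close> was
  white before the move and can only be \<open>d\<close>. The path thus closes the cycle at length
  five.\<close>

lemma path_bwwb_left:
  assumes "bwwb (play U c) b a w z"
  shows "w = e \<and> N a = {b, e} \<and> N e = {a, d}"
proof -
  have l: "leaf_at (play U c) z w" "N a = {b, w}" "N w = {a, z}"
    using assms unfolding bwwb_def by auto
  note lz = leaf_atD[OF l(1)]
  have w: "w \<in> U" "w \<noteq> c" "w \<notin> N c" using lz(2) by (auto simp: mem_play)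
  have wa: "w \<in> N a" using l by auto
  have "wdeg U w = 2" by (rule wdeg_nbr_of_middle[OF w(1) path(15) wa path(11)])
  then have "card (N w \<inter> U) = 2" by (simp add: wdeg_def)
  then have "z \<in> U" using l(3) card_mono[of "{a}" "N w \<inter> U"] by (cases "z \<in> U") auto
  then have "z \<in> {b, c, d}" using lz(1) path_cut by (auto simp: mem_play)
  moreover have "w \<in> N z" using lz(3) .
  ultimately have "z = d" "w = e" using w path(1-3) wa N_irrefl by auto
  then show ?thesis using l by auto
qed

end

text \<open>A blue neighbour of \<open>c\<close> would raise the gain of opening the cycle from 24
  to 25, which a stuck position permits only if a leaf on a middle vertex results.\<close>

lemma middle_nbrs_white:
  assumes "c \<in> U" "wdeg U c = 2"
  shows "N c \<subseteq> U"
proof -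
  obtain a b d e where p: "N c \<inter> U = {b, d}" "N b \<inter> U = {c, a}" "N d \<inter> U = {c, e}"
    "b \<noteq> d" "a \<noteq> c" "e \<noteq> c" "a \<noteq> d" "e \<noteq> b" "a \<notin> N c" "e \<notin> N c"
    "wdeg U a = 2" "wdeg U b = 2" "wdeg U d = 2" "wdeg U e = 2"
    "a \<in> U" "b \<in> U" "d \<in> U" "e \<in> U"
    using middle_path[OF assms] .
  show ?thesis
  proof (cases "a = e")
    case True
    then show ?thesis using middle_cycle4_nbrs[of c a b d] p assms by auto
  next
    case False
    note path = p assms(1) False
    show ?thesis
    proof (rule ccontr)
      assume "\<not> N c \<subseteq> U"
      then obtain x where x: "x \<in> N c" "x \<notin> U" by auto
      have "1 \<le> ploss U c x"
        by (rule ploss_blue_ge_1[OF blue3_U x(2), of c]) (use x N_sym assms in auto)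
      moreover have "sum_list (map (ploss U c) [c, b, d, x]) \<le> gain U c"
        by (rule gain_ge[OF U_subset])
          (use x path path_nbrs[OF path] N_irrefl U_subset N_in_V in auto)
      ultimately have "25 \<le> gain U c" using path_ploss[OF path] by simp
      then show False
        using after_25[OF path_legal[OF path]] path_no_middle_after[OF path] by blast
    qed
  qed
qed

section \<open>Blue vertices and white pairs\<close>

lemma blue_nbr_wdeg_le_1: "x \<notin> U \<Longrightarrow> x \<in> N v \<Longrightarrow> v \<in> U \<Longrightarrow> wdeg U v \<le> 1"
  using middle_nbrs_white[of v] wdeg_le_2[of v] by fastforce

lemma pair_partner:
  assumes "wdeg U v = 1" "v \<in> U"
  obtains w where "N v \<inter> U = {w}" "N w \<inter> U = {v}" "w \<in> U" "wdeg U w = 1" "v \<noteq> w"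
    "v \<in> N w" "w \<in> N v"
proof -
  obtain w where w: "N v \<inter> U = {w}" using assms(1) wdeg_eq_1_iff by auto
  then have wm: "w \<in> U" "w \<in> N v" "v \<in> N w" using N_sym by auto
  have "wdeg U w \<noteq> 2" using wdeg_nbr_of_middle[OF assms(2) wm(1,3)] assms(1) by auto
  then have "wdeg U w = 1"
    using wdeg_le_2[OF wm(1)] wdeg_pos[OF wm(3) assms(2)] by simp
  then show ?thesis
    using that[OF w _ wm(1)] wdeg_eq_1D[OF _ wm(3) assms(2)] wm N_irrefl by auto
qed

text \<open>
  A move is called thin here if it dominates only white vertices with at most one white neighbour;
  it then cannot turn a white vertex into a leaf that allows a cheap reply.
\<close>

lemma leaf_after_thin:
  assumes thin: "\<And>y. y \<in> U \<Longrightarrow> y \<in> insert p (N p) \<Longrightarrow> wdeg U y \<le> 1"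
    and leaf: "leaf_at (play U p) x v" "N v \<inter> play U p \<noteq> {}"
  shows "x \<notin> U" "leaf_at U x v \<or> x \<noteq> p \<and> 2 \<le> wdeg U x \<and> 2 \<le> ploss U p x"
proof -
  note lf = leaf_atD[OF leaf(1)]
  have v: "v \<in> U" using lf(2) play_subset by auto
  show x: "x \<notin> U"
  proof
    assume x: "x \<in> U"
    then have xp: "x \<in> insert p (N p)" using lf(1) by (auto simp: mem_play)
    have "wdeg U x = 1" using thin[OF x xp] wdeg_pos[OF lf(3) v] by simp
    then obtain w where "N x \<inter> U = {w}" "N w \<inter> U = {x}" using pair_partner[OF _ x] by metis
    then have "N v \<inter> U = {x}" using lf(3) v by auto
    then show False using leaf(2) lf(1) play_subset[of U p] by auto
  qed
  show "leaf_at U x v \<or> x \<noteq> p \<and> 2 \<le> wdeg U x \<and> 2 \<le> ploss U p x"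
    using leaf by (cases rule: leaf_on_pair_after) (use x in auto)
qed

text \<open>The leaf would be a vertex that was blue before, and blue vertices are not adjacent to
  white vertices with two white neighbours.\<close>

lemma no_middle_after_thin:
  assumes thin: "\<And>y. y \<in> U \<Longrightarrow> y \<in> insert p (N p) \<Longrightarrow> wdeg U y \<le> 1"
  shows "\<not> leaf_on_middle (play U p)"
proof
  assume "leaf_on_middle (play U p)"
  then obtain x v where xv: "leaf_at (play U p) x v" "2 \<le> wdeg (play U p) v"
    unfolding leaf_on_middle_def by auto
  note lf = leaf_atD[OF xv(1)]
  have v: "v \<in> U" using lf(2) play_subset by auto
  have "N v \<inter> play U p \<noteq> {}" using xv(2) unfolding wdeg_def by auto
  then have "x \<notin> U" using leaf_after_thin(1)[OF thin xv(1)] by auto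
  then show False
    using blue_nbr_wdeg_le_1[OF _ lf(4) v] xv(2) wdeg_play_le[of U p v] by simp
qed

lemma low_after_thin:
  assumes thin: "\<And>y. y \<in> U \<Longrightarrow> y \<in> insert p (N p) \<Longrightarrow> wdeg U y \<le> 1"
    and "low (play U p)"
  obtains x v where "leaf_at (play U p) x v" "N v \<inter> play U p \<noteq> {}"
        "x \<notin> U" "x \<noteq> p" "2 \<le> wdeg U x" "2 \<le> ploss U p x"
  using assms(2)
proof (cases rule: low_after)
  case (1 x v)
  then show ?thesis using leaf_after_thin(1)[OF thin 1(1,2)] by auto
next
  case (2 x v)
  then show ?thesis using that by blast
qed

lemma thin_gain_less_25:
  assumes "\<And>y. y \<in> U \<Longrightarrow> y \<in> insert p (N p) \<Longrightarrow> wdeg U y \<le> 1" "legal U p"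
  shows "gain U p < 25"
  using after_25[OF assms(2)] no_middle_after_thin[OF assms(1)] by force

text \<open>Three white neighbours give 6 + 3 * 6 = 24. The position after the move must then be
  low, and the new leaf that makes it so adds 2.\<close>

lemma blue_wdeg_le_2:
  assumes "x \<in> V - U"
  shows "wdeg U x \<le> 2"
proof (rule ccontr)
  assume "\<not> wdeg U x \<le> 2"
  then have x3: "wdeg U x = 3" using blue3D[OF blue3_U, of x] assms by auto
  let ?A = "N x \<inter> U"
  have A: "card ?A = 3" using x3 by (simp add: wdeg_def)
  have thin: "wdeg U y \<le> 1" if "y \<in> U" "y \<in> insert x (N x)" for y
    using blue_nbr_wdeg_le_1[of x y] that assms N_sym by auto
  have "18 \<le> (\<Sum>v\<in>?A. ploss U x v)"
    using sum_bounded_below[of ?A "6::int" "ploss U x"] A ploss_white_nbr_ge_6'[of _ U x] thin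
    by auto
  moreover have px: "ploss U x x = 6" using assms x3 by (simp add: ploss_blue_self)
  moreover have "(\<Sum>v\<in>insert x ?A. ploss U x v) = ploss U x x + (\<Sum>v\<in>?A. ploss U x v)"
    by (rule sum.insert) (use N_irrefl in auto)
  ultimately have s: "24 \<le> (\<Sum>v\<in>insert x ?A. ploss U x v)" by linarith
  also have "\<dots> \<le> gain U x"
    by (rule gain_ge_sum[OF U_subset]) (use U_subset assms in auto)
  finally have g: "24 \<le> gain U x" .
  obtain v where "v \<in> N x" "v \<in> U" using two_white_nbrs[of U x] x3 by auto
  then have lx: "legal U x" by (rule legal_nbr)
  obtain y u where y: "leaf_at (play U x) y u" "y \<notin> U" "y \<noteq> x" "2 \<le> ploss U x y"
    using low_after_thin[OF thin after_24[OF lx g]] by metis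
  have "(\<Sum>v\<in>insert y (insert x ?A). ploss U x v) = ploss U x y + (\<Sum>v\<in>insert x ?A. ploss U x v)"
    by (rule sum.insert) (use y in auto)
  moreover have "(\<Sum>v\<in>insert y (insert x ?A). ploss U x v) \<le> gain U x"
    by (rule gain_ge_sum[OF U_subset])
      (use U_subset assms leaf_atD(3)[OF y(1)] N_in_V in auto)
  ultimately show False using s y(4) no_26[OF lx] by linarith
qed

text \<open>Let the leaf \<open>z\<close> hang on \<open>w\<close>, and play the partner
  \<open>v\<close>: 10 + 10 + 3, and 1 from another neighbour \<open>x\<close> of \<open>v\<close>.
  This gain 24 forces a new leaf losing 2. If it is \<open>x\<close>, the gain is 25, otherwise 26;
  a thin move may not reach 25.\<close>

lemma no_leaf_on_pair: "\<not> leaf_on_pair U"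
proof
  assume "leaf_on_pair U"
  then obtain z w where leaf: "leaf_at U z w" and "N w \<inter> U \<noteq> {}"
    unfolding leaf_on_pair_def by auto
  note lf = leaf_atD[OF leaf]
  have "wdeg U w = 1"
    using blue_nbr_wdeg_le_1[OF lf(1,4,2)] \<open>N w \<inter> U \<noteq> {}\<close> wdeg_eq_0_iff[of U w] by simp
  then obtain v where v: "N w \<inter> U = {v}" "N v \<inter> U = {w}" "v \<in> U" "wdeg U v = 1" "w \<noteq> v"
    "w \<in> N v" "v \<in> N w"
    using pair_partner lf(2) by metis
  have vV: "v \<in> V" using v(3) U_subset by auto
  obtain x where x: "x \<in> N v" "x \<noteq> w" using other_neighbour[OF vV] .
  have xU: "x \<notin> U" using x v(2) by auto
  have xz: "x \<noteq> z"
  proof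
    assume "x = z"
    then have "v \<in> N z \<inter> U" using N_sym[OF x(1)] v(3) by simp
    then show False using lf(6) v(5) by simp
  qed
  have cut: "U \<inter> insert v (N v) = {v, w}" using v by auto
  have thin: "wdeg U y \<le> 1" if "y \<in> U" "y \<in> insert v (N v)" for y
  proof -
    have "y \<in> {v, w}" unfolding cut[symmetric] using that by simp
    then show ?thesis using v(4) \<open>wdeg U w = 1\<close> by auto
  qed
  have lv: "legal U v" by (rule legal_white[OF U_subset v(3)])
  have base: "ploss U v v = 10" "ploss U v w = 10" "ploss U v z = 3" "1 \<le> ploss U v x"
  proof -
    show "ploss U v v = 10" by (rule ploss_self[OF v(3)])
    show "ploss U v w = 10" by (rule ploss_white_red) (use v lf in auto)
    show "ploss U v z = 3" by (rule ploss_leaf[OF leaf]) (use v in auto)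
    show "1 \<le> ploss U v x"
      by (rule ploss_blue_ge_1[OF blue3_U xU, of v]) (use x v N_sym in auto)
  qed
  have s: "sum_list (map (ploss U v) [v, w, z, x]) \<le> gain U v"
    by (rule gain_ge[OF U_subset]) (use x xU xz v lf U_subset N_in_V in auto)
  then have "24 \<le> gain U v" using base by simp
  then obtain y u where y: "leaf_at (play U v) y u" "y \<notin> U" "y \<noteq> v" "2 \<le> ploss U v y"
    using low_after_thin[OF thin after_24[OF lv]] by metis
  have less: "gain U v < 25" by (rule thin_gain_less_25[OF thin lv])
  have "y \<noteq> x" using less s base y(4) by auto
  moreover have "y \<noteq> z"
  proof
    assume "y = z"
    then have "u = w" using leaf_atD(2,3)[OF y(1)] lf(6) by (auto simp: mem_play)
    then show False using leaf_atD(2)[OF y(1)] v(6) by (auto simp: mem_play)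
  qed
  ultimately have "sum_list (map (ploss U v) [v, w, z, x, y]) \<le> gain U v"
    by (intro gain_ge[OF U_subset])
      (use x xU xz v lf y U_subset N_in_V leaf_atD(3)[OF y(1)] in auto)
  then show False using base y(4) less by simp
qed

lemma thin_blue: "x \<notin> U \<Longrightarrow> y \<in> U \<Longrightarrow> y \<in> insert x (N x) \<Longrightarrow> wdeg U y \<le> 1"
  using blue_nbr_wdeg_le_1[of x y] N_sym by auto

lemma fresh_after_thin:
  assumes thin: "\<And>y. y \<in> U \<Longrightarrow> y \<in> insert p (N p) \<Longrightarrow> wdeg U y \<le> 1"
    and leaf: "leaf_at (play U p) x v" "N v \<inter> play U p \<noteq> {}"
  shows "x \<notin> U" "x \<noteq> p" "2 \<le> ploss U p x" "x \<in> V"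
proof -
  have "\<not> leaf_at U x v"
    using no_leaf_on_pair leaf(2) play_subset[of U p] unfolding leaf_on_pair_def by blast
  then show "x \<notin> U" "x \<noteq> p" "2 \<le> ploss U p x" "x \<in> V"
    using leaf_after_thin[OF thin leaf] leaf_atD(3)[OF leaf(1)] N_in_V by auto
qed

lemma bwwb_after_thin:
  assumes thin: "\<And>y. y \<in> U \<Longrightarrow> y \<in> insert p (N p) \<Longrightarrow> wdeg U y \<le> 1"
    and b: "bwwb (play U p) q v w r"
  shows "q \<notin> U" "q \<noteq> p" "2 \<le> ploss U p q" "q \<in> V"
    "r \<notin> U" "r \<noteq> p" "2 \<le> ploss U p r" "r \<in> V" "q \<noteq> r"
proof -
  have l: "leaf_at (play U p) q v" "leaf_at (play U p) r w" "N v = {q, w}" "N w = {v, r}"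
    using b unfolding bwwb_def by auto
  have ne: "N v \<inter> play U p \<noteq> {}" "N w \<inter> play U p \<noteq> {}"
    using l(3,4) leaf_atD(2)[OF l(1)] leaf_atD(2)[OF l(2)] by auto
  show "q \<notin> U" "q \<noteq> p" "2 \<le> ploss U p q" "q \<in> V"
    using fresh_after_thin[OF thin l(1) ne(1)] by auto
  show "r \<notin> U" "r \<noteq> p" "2 \<le> ploss U p r" "r \<in> V"
    using fresh_after_thin[OF thin l(2) ne(2)] by auto
  have "v \<noteq> w" using l(3) N_irrefl by auto
  then show "q \<noteq> r" using leaf_atD(6)[OF l(1)] leaf_atD(6)[OF l(2)] by auto
qed

lemma bwwb_after_24_thin:
  assumes thin: "\<And>y. y \<in> U \<Longrightarrow> y \<in> insert p (N p) \<Longrightarrow> wdeg U y \<le> 1"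
    and "legal U p" "24 \<le> gain U p"
  obtains q v w r where "bwwb (play U p) q v w r"
  using after_24[OF assms(2,3)] no_middle_after_thin[OF thin] unfolding low_def by blast

text \<open>If \<open>x\<close> had a second white neighbour \<open>u\<close>, playing
  \<open>x\<close> would gain 5 + 10 + 6 + 1 = 22. This forces a new leaf on a pair, which lifts the
  gain to 24. That in turn forces a \<open>bwwb\<close> path, whose two ends lose 2 each: 5 + 10 + 6
  + 2 + 2 = 25.\<close>

lemma single_nbr_leaf:
  assumes t: "t \<in> U" "N t \<inter> U = {}" and x: "x \<in> N t"
  shows "wdeg U x = 1"
proof (rule ccontr)
  assume "wdeg U x \<noteq> 1"
  have tx: "t \<in> N x" using x N_sym by auto
  have xU: "x \<notin> U" using x t by auto
  have xV: "x \<in> V" using x N_in_V by auto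
  have x2: "wdeg U x = 2"
    using \<open>wdeg U x \<noteq> 1\<close> wdeg_pos[OF tx t(1)] blue_wdeg_le_2[of x] xU xV by auto
  obtain u where u: "N x \<inter> U = {t, u}" "t \<noteq> u" using wdeg_eq_2D[OF x2 tx t(1)] .
  then have um: "u \<in> U" "u \<in> N x" "x \<in> N u" using N_sym by auto
  have u1: "wdeg U u \<le> 1" by (rule blue_nbr_wdeg_le_1[OF xU um(3,1)])
  have tV: "t \<in> V" using t U_subset by auto
  obtain x' where x': "x' \<in> N t" "x' \<noteq> x" using other_neighbour[OF tV] .
  have x'U: "x' \<notin> U" using x' t by auto
  have lx: "legal U x" by (rule legal_nbr[OF tx t(1)])
  have thin: "wdeg U y \<le> 1" if "y \<in> U" "y \<in> insert x (N x)" for y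
    using thin_blue[OF xU that] .
  have base: "ploss U x x = 5" "ploss U x t = 10" "1 \<le> ploss U x x'" "6 \<le> ploss U x u"
  proof -
    show "ploss U x x = 5" using xU x2 by (simp add: ploss_blue_self)
    show "ploss U x t = 10" by (rule ploss_white_red) (use t tx in auto)
    show "1 \<le> ploss U x x'"
      by (rule ploss_blue_ge_1[OF blue3_U x'U N_sym[OF x'(1)] t(1)]) (use tx in auto)
    show "6 \<le> ploss U x u" by (rule ploss_white_nbr_ge_6'[OF um(1,2) u1])
  qed
  have s: "sum_list (map (ploss U x) [x, t, u, x']) \<le> gain U x"
    by (rule gain_ge[OF U_subset]) (use t u um xU xV x' x'U U_subset N_in_V in auto)
  have uw1: "wdeg U u = 1"
  proof (rule ccontr)
    assume "wdeg U u \<noteq> 1"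
    then have "N u \<inter> U = {}" using u1 wdeg_eq_0_iff[of U u] by (simp add: le_Suc_eq)
    then have "ploss U x u = 10" using um by (intro ploss_white_red) auto
    then show False using s base no_26[OF lx] by simp
  qed
  obtain w where w: "N u \<inter> U = {w}" "N w \<inter> U = {u}" "w \<in> U" "wdeg U w = 1" "u \<noteq> w"
    "u \<in> N w" "w \<in> N u"
    using pair_partner[OF uw1 um(1)] .
  have "leaf_on_pair (play U x)" using after_22[OF lx] s base by simp
  then obtain y v where y: "leaf_at (play U x) y v" "N v \<inter> play U x \<noteq> {}"
    unfolding leaf_on_pair_def by auto
  note fy = fresh_after_thin[OF thin y]
  have "24 \<le> gain U x"
  proof (cases "y = x'")
    case False
    then have "sum_list (map (ploss U x) [x, t, u, x', y]) \<le> gain U x"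
      by (intro gain_ge[OF U_subset]) (use t u um xU xV x' x'U fy U_subset N_in_V in auto)
    then show ?thesis using base fy by simp
  next
    case True
    \<comment> \<open>The new leaf is \<open>x'\<close> itself, so only 23 is certain. The missing
      unit comes from \<open>u\<close>, or, if \<open>u\<close> is charged for its partner
      \<open>w\<close>, from the second neighbour \<open>z\<close> of \<open>w\<close>, which has
      just become a leaf.\<close>
    show ?thesis
    proof (cases "ploss U x u < 7")
      case False
      then show ?thesis using True fy s base by simp
    next
      case True
      have "wdeg (play U x) u \<le> 1" using u1 wdeg_play_le[of U x u] by simp
      then obtain s where st: "s \<in> trap (play U x)" "N u \<inter> play U x = {s}"
        using ploss_white_less_7[OF um(1,2) _ True] by metis
      have "s = w" using st(2) w(1) by (auto simp: play_def)
      note st = st[unfolded this]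
      have wV: "w \<in> V" using w(3) U_subset by auto
      obtain z where z: "z \<in> N w" "z \<noteq> u" using other_neighbour[OF wV] .
      have zU: "z \<notin> U" using z w(2) by auto
      have z1: "wdeg (play U x) z = 1" using trapD(4)[OF st(1) z(1)] .
      have "wdeg U z \<noteq> 1"
      proof
        assume "wdeg U z = 1"
        then have "leaf_at U z w" using leaf_atI[OF zU _ N_sym[OF z(1)] w(3)] by simp
        then show False using no_leaf_on_pair w(2) unfolding leaf_on_pair_def by auto
      qed
      then have "2 \<le> wdeg U z" using z1 wdeg_play_le[of U x z] by simp
      then have "1 \<le> ploss U x z"
        using z1 zU unfolding loss_def vweight_def bweight_def by (auto simp: mem_play)
      moreover have "z \<noteq> x" using z1 by (auto simp: wdeg_def)
      moreover have "z \<noteq> y"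
      proof
        assume "z = y"
        then have "v = w"
          using wdeg_eq_1D[OF z1 N_sym[OF z(1)] trapD(1)[OF st(1)]] leaf_atD(6)[OF y(1)] by auto
        then show False using y(2) trapD(2)[OF st(1)] by auto
      qed
      moreover have "sum_list (map (ploss U x) [x, t, u, y, z]) \<le> gain U x"
        by (rule gain_ge[OF U_subset])
          (use t u um xU xV fy z zU calculation(2,3) U_subset N_in_V in auto)
      ultimately show ?thesis using base fy by simp
    qed
  qed
  then obtain q a b r where "bwwb (play U x) q a b r"
    using bwwb_after_24_thin[OF thin lx] by metis
  note bb = bwwb_after_thin[OF thin this]
  have "sum_list (map (ploss U x) [x, t, u, q, r]) \<le> gain U x"
    by (rule gain_ge[OF U_subset]) (use t u um xU xV bb U_subset in auto)
  then show False using base bb thin_gain_less_25[OF thin lx] by simp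
qed

section \<open>Tidiness, and the two remaining kinds of components\<close>

lemma tidy_U: "tidy U"
proof -
  have "wdeg U u \<le> 1 \<and> (wdeg U u = 0 \<longrightarrow> wdeg U x = 1)" if "u \<in> U" "x \<in> N u" "x \<notin> U" for u x
    using blue_nbr_wdeg_le_1[OF that(3,2,1)] single_nbr_leaf[OF that(1) _ that(2)]
      wdeg_eq_0_iff[of U u] by auto
  moreover have "wdeg U w = 1" if u: "u \<in> U" "wdeg U u = 1" "w \<in> N u" "w \<in> U" for u w
  proof -
    obtain w' where "N u \<inter> U = {w'}" "wdeg U w' = 1" using pair_partner[OF u(2,1)] by metis
    then show ?thesis using u(3,4) by auto
  qed
  ultimately show ?thesis
    unfolding tidy_def using slim_U no_leaf_on_pair by auto
qed

text \<open>Playing an isolated \<open>t\<close> gains 17 and leaves a tidy position, where every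
  reply gains 17 as well; so this move would be good.\<close>

lemma no_single:
  assumes "t \<in> U"
  shows "wdeg U t \<noteq> 0"
proof
  assume "wdeg U t = 0"
  then have N0: "N t \<inter> U = {}" by (simp add: wdeg_eq_0_iff)
  note sg = single_gain[OF U_subset assms N0 single_nbr_leaf[OF assms N0], of t]
  have nb: "N y \<inter> U = {t}" if "y \<in> N t" for y
    using wdeg_eq_1D[OF single_nbr_leaf[OF assms N0 that] N_sym[OF that] assms] .
  have "separated U {t}"
    unfolding separated_def
  proof (intro conjI allI impI)
    show "{t} \<subseteq> U" using assms by auto
    fix y assume "insert y (N y) \<inter> {t} \<noteq> {}"
    then have "y = t \<or> y \<in> N t" using N_sym by auto
    then show "insert y (N y) \<inter> U \<subseteq> {t}" using nb N0 by fastforce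
  qed
  then have "tidy (play U t)" using tidy_separated[OF tidy_U] sg(2) by simp
  then show False
    using stuck_reply[of t 17] tidy_gain(1) sg(1) legal_white[OF U_subset assms] by simp
qed

text \<open>The blue vertex \<open>y\<close> has exactly one further white neighbour
  \<open>u\<close>, and \<open>u\<close> belongs to another pair, untouched by the move. So
  \<open>y\<close> becomes a leaf on a pair: it drops from 5 to 3 and carries no charge.\<close>

lemma pair_fresh:
  assumes v: "v \<in> U" "w \<in> U" "N v \<inter> U = {w}" "N w \<inter> U = {v}"
    and nc: "N v \<inter> N w = {}"
    and s: "s \<in> {v, w}" "y \<in> N s" "y \<notin> U"
  shows "2 \<le> ploss U v y"
proof -
  have sU: "s \<in> U" "N s \<inter> U \<noteq> {}" using v s by auto
  have sy: "s \<in> N y" using N_sym s(2) by auto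
  have yV: "y \<in> V" using s(2) N_in_V by auto
  have "wdeg U y \<noteq> 1"
  proof
    assume "wdeg U y = 1"
    then have "leaf_at U y s" using leaf_atI[OF s(3) _ sy sU(1)] by simp
    then show False using no_leaf_on_pair sU(2) unfolding leaf_on_pair_def by auto
  qed
  then have y2: "wdeg U y = 2"
    using wdeg_pos[OF sy sU(1)] blue_wdeg_le_2[of y] s(3) yV by auto
  obtain u where u: "N y \<inter> U = {s, u}" "s \<noteq> u" using wdeg_eq_2D[OF y2 sy sU(1)] .
  have um: "u \<in> U" "u \<in> N y" "y \<in> N u" using u N_sym by auto
  have uvw: "u \<notin> {v, w}"
  proof
    assume "u \<in> {v, w}"
    then have "y \<in> N v \<inter> N w" using s(1,2) u(2) um(3) by auto
    then show False using nc by simp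
  qed
  have u1: "wdeg U u \<le> 1" by (rule blue_nbr_wdeg_le_1[OF s(3) um(3,1)])
  have u0: "wdeg U u \<noteq> 0" by (rule no_single[OF um(1)])
  then obtain w' where w': "N u \<inter> U = {w'}" "N w' \<inter> U = {u}" "w' \<in> U"
    using u1 pair_partner[of u] um(1) by (metis One_nat_def le_Suc_eq le_zero_eq)
  have "w' \<notin> {v, w}" using w'(2) v(3,4) uvw by auto
  then have pl: "u \<in> play U v" "w' \<in> play U v"
    using um(1) w'(3) uvw v(3) by (auto simp: mem_play)
  have "s \<notin> play U v" using s(1) v(3) by (auto simp: mem_play)
  then have Ny: "N y \<inter> play U v = {u}"
    using u(1) pl(1) um(2) play_subset[of U v] by auto
  have "u \<notin> trap (play U v)"
    by (rule not_trap[OF pl(1)]) (use w'(1) pl(2) in auto)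
  then show ?thesis
    using loss_blue_new_leaf[OF play_subset s(3) _ Ny] y2 by simp
qed

text \<open>Playing \<open>v\<close> gains 20 for the pair and 2 for each blue neighbour of
  \<open>v\<close> or \<open>w\<close>. The bound 25 leaves room for one on each side. The gain is
  then 24, and the resulting \<open>bwwb\<close> path joins \<open>x\<close> to \<open>z\<close> and
  closes a 6-cycle.\<close>

lemma pair_structure:
  assumes "v \<in> U" "wdeg U v = 1"
  obtains w x z a b where "N v = {w, x}" "N w = {v, z}" "N a = {x, b}" "N b = {a, z}"
    "x \<notin> U" "z \<notin> U" "w \<in> U" "a \<in> U" "b \<in> U" "N x \<inter> U = {v, a}" "N z \<inter> U = {w, b}"
    "24 \<le> gain U v" "\<not> leaf_on_middle (play U v)"
    "\<forall>q a' b' r. bwwb (play U v) q a' b' r \<longrightarrow> {a', b'} = {a, b}"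
proof -
  obtain w where w: "N v \<inter> U = {w}" "N w \<inter> U = {v}" "w \<in> U" "wdeg U w = 1" "v \<noteq> w"
    "v \<in> N w" "w \<in> N v"
    using pair_partner[OF assms(2,1)] .
  have cut: "U \<inter> insert v (N v) = {v, w}" using w assms by auto
  have thin: "wdeg U y \<le> 1" if "y \<in> U" "y \<in> insert v (N v)" for y
  proof -
    have "y \<in> {v, w}" unfolding cut[symmetric] using that by simp
    then show ?thesis using w(4) assms(2) by auto
  qed
  have lv: "legal U v" by (rule legal_white[OF U_subset assms(1)])
  have less: "gain U v < 25" by (rule thin_gain_less_25[OF thin lv])
  have base: "ploss U v v = 10" "ploss U v w = 10"
    using ploss_self[OF assms(1)] ploss_white_red[of w U v] w by auto
  have nbr_blue: "y \<notin> U" if "y \<in> N v \<and> y \<noteq> w \<or> y \<in> N w \<and> y \<noteq> v" for y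
    using that w(1,2) by auto
  \<comment> \<open>A common blue neighbour would lose its whole weight 5, giving 10 + 10 +
    5.\<close>
  have nc: "N v \<inter> N w = {}"
  proof (rule ccontr)
    assume "N v \<inter> N w \<noteq> {}"
    then obtain x where x: "x \<in> N v" "x \<in> N w" by auto
    have xw: "x \<noteq> w" using x(2) N_irrefl by auto
    have xU: "x \<notin> U" using nbr_blue x xw by auto
    have xV: "x \<in> V" using x N_in_V by auto
    have "wdeg U x \<le> 2" using blue_wdeg_le_2[of x] xU xV by auto
    then have Nx: "N x \<inter> U = {v, w}"
      using wdeg2_nbrs[of U x v w] N_sym x assms(1) w(3,5) by auto
    then have "wdeg U x = 2" using w(5) by (simp add: wdeg_def)
    moreover have "ploss U v x = bweight (wdeg U x)"
      by (rule ploss_blue_red[OF xU]) (use Nx w in auto)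
    moreover have "sum_list (map (ploss U v) [v, w, x]) \<le> gain U v"
      by (rule gain_ge[OF U_subset]) (use assms w xU xV xw U_subset in auto)
    ultimately show False using base less by simp
  qed
  have fresh2: "2 \<le> ploss U v y" if "y \<in> N v \<and> y \<noteq> w \<or> y \<in> N w \<and> y \<noteq> v" for y
    using pair_fresh[OF assms(1) w(3,1,2) nc, of v y] pair_fresh[OF assms(1) w(3,1,2) nc, of w y]
      that nbr_blue[OF that] by auto
  have vV: "v \<in> V" "w \<in> V" using assms(1) w(3) U_subset by auto
  obtain x where x: "x \<in> N v" "x \<noteq> w" using other_neighbour[OF vV(1)] .
  obtain z where z: "z \<in> N w" "z \<noteq> v" using other_neighbour[OF vV(2)] .
  have xz: "x \<noteq> z" using x z nc by auto
  have xzU: "x \<notin> U" "z \<notin> U" using nbr_blue x z by auto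
  have xzV: "x \<in> V" "z \<in> V" using x z N_in_V by auto
  have xz2: "2 \<le> ploss U v x" "2 \<le> ploss U v z" using fresh2 x z by auto
  have only: "y = x \<or> y = z" if "y \<in> V" "y \<notin> U" "2 \<le> ploss U v y" for y
  proof (rule ccontr)
    assume y: "\<not> (y = x \<or> y = z)"
    have "sum_list (map (ploss U v) [v, w, x, z, y]) \<le> gain U v"
      by (rule gain_ge[OF U_subset]) (use that y vV assms(1) w(3,5) xz xzU xzV in auto)
    then show False using base xz2 that(3) less by simp
  qed
  have "sum_list (map (ploss U v) [v, w, x, z]) \<le> gain U v"
    by (rule gain_ge[OF U_subset]) (use vV assms(1) w(3,5) xz xzU xzV in auto)
  then have g: "24 \<le> gain U v" using base xz2 by simp
  have ends: "q = x \<and> r = z \<or> q = z \<and> r = x" if "bwwb (play U v) q a' b' r" for q a' b' r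
    using bwwb_after_thin[OF thin that] only[of q] only[of r] by auto
  obtain a b where ab: "bwwb (play U v) x a b z"
    using bwwb_after_24_thin[OF thin lv g] ends bwwb_commute by metis
  then have l: "leaf_at (play U v) x a" "leaf_at (play U v) z b" "N a = {x, b}" "N b = {a, z}"
    unfolding bwwb_def by auto
  note la = leaf_atD[OF l(1)] and lb = leaf_atD[OF l(2)]
  have abU: "a \<in> U" "b \<in> U" using la(2) lb(2) play_subset by auto
  have Nv: "N v = {w, x}"
  proof -
    have "y = w \<or> y = x" if y: "y \<in> N v" for y
    proof (rule ccontr)
      assume "\<not> ?thesis"
      then have "y = z" using only[of y] nbr_blue[of y] fresh2[of y] y N_in_V by auto
      then show False using y z nc by auto
    qed
    then show ?thesis using x w(7) by auto
  qed
  have Nw: "N w = {v, z}"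
  proof -
    have "y = v \<or> y = z" if y: "y \<in> N w" for y
    proof (rule ccontr)
      assume "\<not> ?thesis"
      then have "y = x" using only[of y] nbr_blue[of y] fresh2[of y] y N_in_V by auto
      then show False using y x nc by auto
    qed
    then show ?thesis using z w(6) by auto
  qed
  have nab: "a \<noteq> v" "b \<noteq> w" using la(2) lb(2) w(7) by (auto simp: mem_play)
  have Nx: "N x \<inter> U = {v, a}"
    using wdeg2_nbrs[of U x v a] blue_wdeg_le_2[of x] xzU xzV N_sym[OF x(1)] la(3) assms(1) abU nab
    by auto
  have Nz: "N z \<inter> U = {w, b}"
    using wdeg2_nbrs[of U z w b] blue_wdeg_le_2[of z] xzU xzV N_sym[OF z(1)] lb(3) w(3) abU nab
    by auto
  have uniq: "{a', b'} = {a, b}" if b': "bwwb (play U v) q a' b' r" for q a' b' r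
  proof -
    have l': "N q \<inter> play U v = {a'}" "N r \<inter> play U v = {b'}"
      using b' leaf_atD(6) unfolding bwwb_def by blast+
    then show ?thesis using ends[OF b'] la(6) lb(6) by auto
  qed
  show ?thesis
    using that[OF Nv Nw l(3,4) xzU w(3) abU Nx Nz g no_middle_after_thin[OF thin]] uniq by simp
qed

text \<open>Opening a white 4-cycle at \<open>c\<close> gains only 22, but this suffices: the
  remaining vertex \<open>a\<close> has no white neighbour, so no leaf on a pair arises.\<close>

lemma no_cycle4:
  assumes "c \<in> U" "a \<in> U" "a \<noteq> c" "N c \<inter> U = {b, d}" "N b \<inter> U = {c, a}" "N d \<inter> U = {c, a}"
    and "b \<noteq> d" "wdeg U b = 2" "wdeg U d = 2" "wdeg U c = 2"
  shows False
proof -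
  have m: "b \<in> U" "d \<in> U" "b \<in> N c" "d \<in> N c" "c \<in> N b" "c \<in> N d" "a \<in> N b" "a \<in> N d"
    using assms(4-6) by auto
  have ma: "b \<in> N a" "d \<in> N a" using m N_sym by auto
  have Na: "N a \<inter> U = {b, d}"
    by (rule wdeg2_nbrs[OF wdeg_le_2[OF assms(2)] ma(1) m(1) ma(2) m(2) assms(7)])
  have cut: "U \<inter> insert c (N c) = {b, c, d}" using assms(1,4) by auto
  have "sum_list (map (ploss U c) [c, b, d]) \<le> gain U c"
    by (rule gain_ge[OF U_subset]) (use m assms N_irrefl U_subset in auto)
  moreover have "6 \<le> ploss U c b" "6 \<le> ploss U c d"
    using ploss_white_nbr_ge_6[OF slim_U] m assms(1) by auto
  ultimately have "22 \<le> gain U c" using ploss_self[OF assms(1)] by simp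
  then have "leaf_on_pair (play U c)" using after_22 legal_white[OF U_subset assms(1)] by simp
  then obtain x v where xv: "leaf_at (play U c) x v" "N v \<inter> play U c \<noteq> {}"
    unfolding leaf_on_pair_def by auto
  note lf = leaf_atD[OF xv(1)]
  have v: "v \<in> U" "v \<noteq> c" "v \<notin> N c" using lf(2) by (auto simp: mem_play)
  from xv show False
  proof (cases rule: leaf_on_pair_after)
    case 1
    then show ?thesis
      using no_leaf_on_pair xv(2) play_subset[of U c] unfolding leaf_on_pair_def by blast
  next
    case 2
    then have "x = b \<or> x = c \<or> x = d" using cut by auto
    then have "v = a"
      using lf(3) v cap2D[OF assms(5), of v] cap2D[OF assms(6), of v] by auto
    then have "N v \<inter> play U c = {}" using Na m(3,4) by (auto simp: play_def)
    then show ?thesis using xv(2) by simp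
  next
    case 3
    \<comment> \<open>A blue \<open>x\<close> that became a leaf has lost a white neighbour
      \<open>r\<close> on the cycle, but vertices of the cycle have no blue neighbours.\<close>
    have "\<not> N x \<inter> U \<subseteq> {v}"
      using card_mono[of "{v}" "N x \<inter> U"] 3(2) by (auto simp: wdeg_def)
    then obtain r where r: "r \<in> N x" "r \<in> U" "r \<noteq> v" by auto
    then have "r \<notin> play U c" using lf(6) by auto
    then have "r \<in> U \<inter> insert c (N c)" using r by (auto simp: mem_play)
    then have "wdeg U r = 2" unfolding cut using assms(8-10) by auto
    then have "N r \<subseteq> U" by (rule middle_nbrs_white[OF r(2)])
    then show ?thesis using N_sym[OF r(1)] 3(1) by auto
  qed
qed

text \<open>The gain 24 forces a \<open>bwwb\<close> path after the move; its ends can only be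
  \<open>b\<close> and \<open>d\<close>, so \<open>a\<close> and \<open>e\<close> are adjacent. The
  last conclusion identifies the two vertices left white in the component.\<close>

lemma middle_structure:
  assumes "c \<in> U" "wdeg U c = 2"
  obtains a b d e where "N c = {b, d}" "N b = {c, a}" "N d = {c, e}" "N a = {b, e}" "N e = {d, a}"
    "a \<in> U" "b \<in> U" "d \<in> U" "e \<in> U"
    "24 \<le> gain U c" "\<not> leaf_on_middle (play U c)"
    "\<forall>q a' b' r. bwwb (play U c) q a' b' r \<longrightarrow> {a', b'} = {a, e}"
proof -
  obtain a b d e where p: "N c \<inter> U = {b, d}" "N b \<inter> U = {c, a}" "N d \<inter> U = {c, e}"
    "b \<noteq> d" "a \<noteq> c" "e \<noteq> c" "a \<noteq> d" "e \<noteq> b" "a \<notin> N c" "e \<notin> N c"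
    "wdeg U a = 2" "wdeg U b = 2" "wdeg U d = 2" "wdeg U e = 2"
    "a \<in> U" "b \<in> U" "d \<in> U" "e \<in> U"
    using middle_path[OF assms] .
  have "a \<noteq> e" using no_cycle4[of c a b d] p assms by auto
  note path = p assms(1) this
  have bw: "q = b \<and> a' = a \<and> r = d \<and> b' = e \<or> q = d \<and> a' = e \<and> r = b \<and> b' = a"
    if b': "bwwb (play U c) q a' b' r" for q a' b' r
  proof -
    have l: "leaf_at (play U c) q a'" "leaf_at (play U c) r b'" "N a' = {q, b'}" "N b' = {a', r}"
      using b' unfolding bwwb_def by auto
    have ne: "N a' \<inter> play U c \<noteq> {}" "N b' \<inter> play U c \<noteq> {}"
      using l(3,4) leaf_atD(2)[OF l(1)] leaf_atD(2)[OF l(2)] by auto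
    then have "\<not> leaf_at U q a'" "\<not> leaf_at U r b'"
      using no_leaf_on_pair play_subset[of U c] unfolding leaf_on_pair_def by blast+
    moreover have "a' \<noteq> b'" using l(3) N_irrefl by auto
    ultimately show ?thesis
      using path_leaf_after[OF path l(1) ne(1)] path_leaf_after[OF path l(2) ne(2)] by auto
  qed
  obtain q a' b' r where "bwwb (play U c) q a' b' r"
    using after_24[OF path_legal[OF path] path_gain[OF path]] path_no_middle_after[OF path]
    unfolding low_def by blast
  then have "bwwb (play U c) b a e d" using bw bwwb_commute by metis
  from path_bwwb_left[OF path this] have Nae: "N a = {b, e}" "N e = {d, a}"
    by (simp_all add: insert_commute)
  have closed: "N x \<inter> U = N x" if "x \<in> U" "wdeg U x = 2" for x
    by (rule Int_absorb2[OF middle_nbrs_white[OF that]])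
  have "N b = {c, a}" "N d = {c, e}" "N c = {b, d}"
    using p(1-3) closed[OF p(16,12)] closed[OF p(17,13)] closed[OF assms] by simp_all
  moreover have "{a', b'} = {a, e}" if "bwwb (play U c) q a' b' r" for q a' b' r
    using bw[OF that] by auto
  ultimately show ?thesis
    using that[of b d a e] Nae p(15-18) path_gain[OF path] path_no_middle_after[OF path] by simp
qed

section \<open>Dominator's strategy in a stuck position\<close>

lemma opening_move:
  assumes "U \<noteq> {}"
  obtains p R where "p \<in> U" "separated U R" "24 \<le> gain U p" "\<not> leaf_on_middle (play U p)"
    "\<forall>q v w r. bwwb (play U p) q v w r \<longrightarrow> play U p - {v, w} = U - R"
proof -
  obtain u where u: "u \<in> U" using assms by auto
  consider "wdeg U u = 1" | "wdeg U u = 2"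
    using no_single[OF u] wdeg_le_2[OF u] by linarith
  then show ?thesis
  proof cases
    case 1
    obtain w x z a b where s: "N u = {w, x}" "N w = {u, z}" "N a = {x, b}" "N b = {a, z}"
      "x \<notin> U" "z \<notin> U" "w \<in> U" "a \<in> U" "b \<in> U" "N x \<inter> U = {u, a}" "N z \<inter> U = {w, b}"
      "24 \<le> gain U u" "\<not> leaf_on_middle (play U u)"
      "\<forall>q a' b' r. bwwb (play U u) q a' b' r \<longrightarrow> {a', b'} = {a, b}"
      using pair_structure[OF u 1] .
    let ?R = "{u, w, a, b}"
    have "separated U ?R"
      unfolding separated_def
    proof (intro conjI allI impI)
      show "?R \<subseteq> U" using u s(7-9) by auto
      fix y assume "insert y (N y) \<inter> ?R \<noteq> {}"
      then have "y \<in> ?R \<or> u \<in> N y \<or> w \<in> N y \<or> a \<in> N y \<or> b \<in> N y" by auto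
      then have "y \<in> ?R \<or> y \<in> N u \<or> y \<in> N w \<or> y \<in> N a \<or> y \<in> N b" using N_sym by auto
      then have "y = u \<or> y = w \<or> y = a \<or> y = b \<or> y = x \<or> y = z" using s(1-4) by auto
      then show "insert y (N y) \<inter> U \<subseteq> ?R"
        by (elim disjE) (use s(1-6,10,11) in auto)
    qed
    moreover have "play U u - {v', w'} = U - ?R" if "bwwb (play U u) q v' w' r" for q v' w' r
      using s(14) that s(1,5) by (auto simp: play_def)
    ultimately show ?thesis using that[of u ?R] u s(12,13) by auto
  next
    case 2
    obtain a b d e where s: "N u = {b, d}" "N b = {u, a}" "N d = {u, e}" "N a = {b, e}"
      "N e = {d, a}" "a \<in> U" "b \<in> U" "d \<in> U" "e \<in> U"
      "24 \<le> gain U u" "\<not> leaf_on_middle (play U u)"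
      "\<forall>q a' b' r. bwwb (play U u) q a' b' r \<longrightarrow> {a', b'} = {a, e}"
      using middle_structure[OF u 2] .
    let ?R = "{u, a, b, d, e}"
    have "separated U ?R"
      unfolding separated_def
    proof (intro conjI allI impI)
      show "?R \<subseteq> U" using u s(6-9) by auto
      fix y assume "insert y (N y) \<inter> ?R \<noteq> {}"
      then have "y \<in> ?R \<or> u \<in> N y \<or> a \<in> N y \<or> b \<in> N y \<or> d \<in> N y \<or> e \<in> N y" by auto
      then have "y \<in> ?R \<or> y \<in> N u \<or> y \<in> N a \<or> y \<in> N b \<or> y \<in> N d \<or> y \<in> N e"
        using N_sym by auto
      then have "y = u \<or> y = a \<or> y = b \<or> y = d \<or> y = e" using s(1-5) by auto
      then show "insert y (N y) \<inter> U \<subseteq> ?R"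
        by (elim disjE) (use s(1-5) in auto)
    qed
    moreover have "play U u - {v', w'} = U - ?R" if "bwwb (play U u) q v' w' r" for q v' w' r
      using s(12) that s(1) by (auto simp: play_def)
    ultimately show ?thesis using that[of u ?R] u s(10,11) by auto
  qed
qed

lemma stuck_strategy:
  assumes "U \<noteq> {}"
  shows "\<exists>p. good_twice U p"
proof -
  obtain p R where p: "p \<in> U" "separated U R" "24 \<le> gain U p" "\<not> leaf_on_middle (play U p)"
    "\<forall>q v w r. bwwb (play U p) q v w r \<longrightarrow> play U p - {v, w} = U - R"
    using opening_move[OF assms] .
  let ?U1 = "play U p"
  note slim1 = slim_play[OF slim_U, of p]
  have "\<exists>r. legal (play ?U1 q) r \<and> 17 \<le> gain (play ?U1 q) r \<and> 9 \<le> gain ?U1 q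
      \<and> (\<forall>s. legal (play (play ?U1 q) r) s \<longrightarrow> 18 \<le> gain (play (play ?U1 q) r) s)"
    if q: "legal ?U1 q" "gain ?U1 q < 10" for q
  proof -
    obtain v w z where b: "bwwb ?U1 q v w z"
      using gain_less_10[OF slim1 blue3_play[OF blue3_U slim_U] q(1) p(4) q(2)] by auto
    then have l: "leaf_at ?U1 q v" "leaf_at ?U1 z w" "N v = {q, w}" "N w = {v, z}"
      unfolding bwwb_def by auto
    note lq = leaf_atD[OF l(1)] and lz = leaf_atD[OF l(2)]
    have vw: "v \<noteq> w" using l(3) N_irrefl by auto
    let ?U2 = "play ?U1 q"
    \<comment> \<open>The cheap reply at the leaf \<open>q\<close> dominates \<open>v\<close> only.
      Then \<open>w\<close> is isolated among the white vertices, with the leaves \<open>v\<close>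
      and \<open>z\<close> as neighbours, and playing \<open>w\<close> clears the rest of the
      component.\<close>
    have U2: "?U2 = ?U1 - {v}" using lq by (auto simp: play_def[of ?U1 q])
    have U2V: "?U2 \<subseteq> V" using slimD(1)[OF slim_play[OF slim1]] .
    have w2: "w \<in> ?U2" using U2 lz(2) vw by auto
    have Nw: "N w \<inter> ?U2 = {}" using U2 l(4) lz(1) by auto
    have "N v \<inter> ?U2 = {w}" using U2 l(3) w2 lq(1) by auto
    moreover have "N z \<inter> ?U2 = {w}" using U2 lz(6) w2 by auto
    ultimately have "wdeg ?U2 y = 1" if "y \<in> N w" for y
      using that l(4) wdeg_eq_1_iff by auto
    note sg = single_gain[OF U2V w2 Nw this insertI1]
    have "play ?U2 w = ?U1 - {v, w}" using sg(2) U2 by auto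
    also have "\<dots> = U - R" using p(5) b by blast
    finally have "play ?U2 w = U - R" .
    moreover have "tidy (U - R)" by (rule tidy_separated[OF tidy_U p(2)])
    moreover have "wdeg (U - R) u \<noteq> 0" if "u \<in> U - R" for u
      using separated_wdeg(1)[OF p(2) that, of u] no_single[of u] that by auto
    ultimately have "18 \<le> gain (play ?U2 w) s" if "legal (play ?U2 w) s" for s
      using tidy_gain(2) that by metis
    moreover have "9 \<le> gain ?U1 q" by (rule gain_ge_9[OF slim1 q(1) p(4)])
    moreover have "legal ?U2 w" by (rule legal_white[OF U2V w2])
    ultimately show ?thesis using sg(1) by auto
  qed
  note reply = this
  show ?thesis
    unfolding good_twice_def
  proof (intro exI[of _ p] conjI allI impI)
    show "legal U p" by (rule legal_white[OF U_subset p(1)])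
    show "17 \<le> gain U p" using p(3) by simp
    fix q assume q: "legal ?U1 q"
    show "34 \<le> gain U p + gain ?U1 q
       \<or> (\<exists>r. legal (play ?U1 q) r
            \<and> 50 \<le> gain U p + gain ?U1 q + gain (play ?U1 q) r
            \<and> (\<forall>s. legal (play (play ?U1 q) r) s \<longrightarrow>
                 68 \<le> gain U p + gain ?U1 q + gain (play ?U1 q) r
                   + gain (play (play ?U1 q) r) s))"
    proof (cases "gain ?U1 q < 10")
      case False
      \<comment> \<open>The opening move and a reply of at least 10 already give 24 + 10.\<close>
      then show ?thesis using p(3) by linarith
    next
      case True
      then obtain r where r: "legal (play ?U1 q) r" "17 \<le> gain (play ?U1 q) r" "9 \<le> gain ?U1 q"
        "\<And>s. legal (play (play ?U1 q) r) s \<Longrightarrow> 18 \<le> gain (play (play ?U1 q) r) s"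
        using reply[OF q] by blast
      \<comment> \<open>24 + 9 + 17 + 18; without the last move 50 remain.\<close>
      have "68 \<le> gain U p + gain ?U1 q + gain (play ?U1 q) r + gain (play (play ?U1 q) r) s"
        if "legal (play (play ?U1 q) r) s" for s
        using r(2,3) r(4)[OF that] p(3) by linarith
      moreover have "50 \<le> gain U p + gain ?U1 q + gain (play ?U1 q) r"
        using r(2,3) p(3) by linarith
      ultimately show ?thesis using r(1) by blast
    qed
  qed
qed

end

section \<open>From the potential to the game\<close>

context pair_graph
begin

definition white :: "'a set \<Rightarrow> 'a set" where
  "white S = pverts G - dominated S"

definition nbrs :: "'a \<Rightarrow> 'a set" where
  "nbrs x = {y. (x, y) \<in> parcs G}"

lemma nbrs_sym: "y \<in> nbrs x \<Longrightarrow> x \<in> nbrs y"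
  using sym_arcs by (auto simp: nbrs_def symmetric_def dest: symD)

lemma white_insert: "v \<in> pverts G \<Longrightarrow> white (insert v S) = white S - insert v (nbrs v)"
  by (auto simp: white_def dominated_def nbrs_def)

lemma legal_moves_iff:
  "v \<in> legal_moves S \<longleftrightarrow> v \<in> pverts G \<and> insert v (nbrs v) \<inter> white S \<noteq> {}"
proof (cases "v \<in> pverts G")
  case True
  have fin: "finite (dominated (insert v S))" "dominated S \<subseteq> dominated (insert v S)"
    by (auto simp: dominated_def)
  have "card (dominated S) < card (dominated (insert v S)) \<longleftrightarrow> dominated S \<noteq> dominated (insert v S)"
    using fin by (metis card_subset_eq less_irrefl psubsetI psubset_card_mono)
  also have "\<dots> \<longleftrightarrow> insert v (nbrs v) \<inter> white S \<noteq> {}"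
    using True by (fastforce simp: dominated_def white_def nbrs_def dest: in_arcsD2)
  finally show ?thesis using True by (simp add: legal_moves_def)
qed (simp add: legal_moves_def)

lemma white_empty_iff: "white S = {} \<longleftrightarrow> dominated S = pverts G"
  using dominated_subset by (auto simp: white_def)

lemma dominator_moves_terminal: "white S = {} \<Longrightarrow> dominator_moves S = 0"
  by (simp add: dominator_moves.simps white_empty_iff)

lemma staller_moves_terminal: "white S = {} \<Longrightarrow> staller_moves S = 0"
  by (simp add: staller_moves.simps white_empty_iff)

lemma dominator_moves_le:
  assumes "v \<in> legal_moves S"
  shows "dominator_moves S \<le> Suc (staller_moves (insert v S))"
  by (subst dominator_moves.simps) (use assms finite_legal_moves in \<open>auto intro: Min_le\<close>)

lemma staller_moves_obtains:
  assumes "white S \<noteq> {}"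
  obtains q where "q \<in> legal_moves S" "staller_moves S = Suc (dominator_moves (insert q S))"
proof -
  have ne: "dominated S \<noteq> pverts G" using assms white_empty_iff by auto
  have "Max ((\<lambda>v. dominator_moves (insert v S)) ` legal_moves S)
      \<in> (\<lambda>v. dominator_moves (insert v S)) ` legal_moves S"
    by (rule Max_in) (use finite_legal_moves legal_moves_nonempty[OF ne] in auto)
  then obtain q where q: "q \<in> legal_moves S"
    "Max ((\<lambda>v. dominator_moves (insert v S)) ` legal_moves S) = dominator_moves (insert q S)"
    by auto
  show ?thesis by (rule that[OF q(1)]) (use q(2) ne in \<open>simp add: staller_moves.simps[of S]\<close>)
qed

end

locale pair_graph_min_degree_two = pair_graph G for G :: "'a pair_pre_digraph" +
  assumes min_degree: "v \<in> pverts G \<Longrightarrow> 2 \<le> out_degree (with_proj G) v"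
begin

lemma card_nbrs: "card (nbrs v) = out_degree (with_proj G) v"
proof -
  have "out_arcs (with_proj G) v = Pair v ` nbrs v"
    by (auto simp: out_arcs_def nbrs_def)
  then show ?thesis by (simp add: out_degree_def card_image inj_on_def)
qed

sublocale min_degree_two "pverts G" nbrs
proof
  show "finite (pverts G)" by (rule pair_finite_verts)
  show "nbrs x \<subseteq> pverts G" for x by (auto simp: nbrs_def dest: in_arcsD2)
  show "x \<in> nbrs y" if "y \<in> nbrs x" for x y by (rule nbrs_sym[OF that])
  show "x \<notin> nbrs x" for x using pair_no_loops by (fastforce simp: nbrs_def)
  show "2 \<le> card (nbrs x)" if "x \<in> pverts G" for x
    using min_degree[OF that] by (simp add: card_nbrs)
qed

lemma legal_moves_eq: "v \<in> legal_moves S \<longleftrightarrow> legal (white S) v"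
  by (simp add: legal_moves_iff legal_def)

lemma white_insert_eq: "v \<in> legal_moves S \<Longrightarrow> white (insert v S) = play (white S) v"
  by (simp add: white_insert legal_moves_iff play_def)

lemma card_white_less:
  assumes "v \<in> legal_moves S"
  shows "card (white (insert v S)) < card (white S)"
proof (rule psubset_card_mono)
  show "finite (white S)" by (simp add: white_def)
  show "white (insert v S) \<subset> white S"
    using assms white_insert[of v S] by (auto simp: legal_moves_iff)
qed

text \<open>The assumption on 17 settles the case that \<open>p\<close> ends the game. The bound
  \<open>B\<close> is arbitrary so that a second round can be played with \<open>B\<close> lowered
  by 34.\<close>

lemma two_moves:
  assumes "p \<in> legal_moves S" "17 \<le> B"
    "\<And>q. q \<in> legal_moves (insert p S) \<Longrightarrow> 17 * int (dominator_moves (insert q (insert p S))) + 34 \<le> B"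
  shows "17 * int (dominator_moves S) \<le> B"
proof (cases "white (insert p S) = {}")
  case True
  then show ?thesis using dominator_moves_le[OF assms(1)] staller_moves_terminal assms(2) by simp
next
  case False
  then obtain q where "q \<in> legal_moves (insert p S)"
    "staller_moves (insert p S) = Suc (dominator_moves (insert q (insert p S)))"
    using staller_moves_obtains by metis
  then show ?thesis using dominator_moves_le[OF assms(1)] assms(3)[of q] by simp
qed

section \<open>Induction on the number of undominated vertices\<close>

lemma slim_bound:
  assumes "slim (white S)"
  shows "17 * int (dominator_moves S) \<le> pot (white S) + 1"
  using assms
proof (induction "card (white S)" arbitrary: S rule: less_induct)
  case less
  let ?U = "white S"
  have IH: "17 * int (dominator_moves S') \<le> pot (white S') + 1"
    if "card (white S') < card ?U" "white S' \<subseteq> ?U" for S'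
    using less.hyps[OF that(1)] slim_subset[OF less.prems that(2)] by simp
  show ?case
  proof (cases "\<exists>p. good ?U p")
    case True
    then obtain p where p: "good ?U p" by auto
    then have pl: "p \<in> legal_moves S" by (simp add: good_def legal_moves_eq)
    note pw = white_insert_eq[OF pl]
    show ?thesis
    proof (rule two_moves[OF pl])
      show "17 \<le> pot ?U + 1"
        using p pot_nonneg[of "play ?U p"] by (simp add: good_def gain_def)
      fix q assume q: "q \<in> legal_moves (insert p S)"
      note qw = white_insert_eq[OF q]
      have "34 \<le> gain ?U p + gain (play ?U p) q"
        using p q by (simp add: good_def legal_moves_eq pw)
      moreover have "17 * int (dominator_moves (insert q (insert p S)))
          \<le> pot (white (insert q (insert p S))) + 1"
        by (rule IH) (use card_white_less[OF pl] card_white_less[OF q] qw pw mem_play in auto)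
      ultimately show "17 * int (dominator_moves (insert q (insert p S))) + 34 \<le> pot ?U + 1"
        by (simp add: gain_def qw pw)
    qed
  next
    case False
    then interpret stuck "pverts G" nbrs ?U
      by unfold_locales (use less.prems in auto)
    show ?thesis
    proof (cases "?U = {}")
      case True
      then show ?thesis using dominator_moves_terminal pot_nonneg[of ?U] by simp
    next
      case False
      then obtain p where p: "legal ?U p" "17 \<le> gain ?U p" and
        reply: "\<And>q. legal (play ?U p) q \<Longrightarrow> 34 \<le> gain ?U p + gain (play ?U p) q
          \<or> (\<exists>r. legal (play (play ?U p) q) r
            \<and> 50 \<le> gain ?U p + gain (play ?U p) q + gain (play (play ?U p) q) r
            \<and> (\<forall>s. legal (play (play (play ?U p) q) r) s \<longrightarrow>
                 68 \<le> gain ?U p + gain (play ?U p) q + gain (play (play ?U p) q) r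
                   + gain (play (play (play ?U p) q) r) s))"
        using stuck_strategy unfolding good_twice_def by metis
      have pl: "p \<in> legal_moves S" using p by (simp add: legal_moves_eq)
      note pw = white_insert_eq[OF pl]
      show ?thesis
      proof (rule two_moves[OF pl])
        show "17 \<le> pot ?U + 1"
          using p(2) pot_nonneg[of "play ?U p"] by (simp add: gain_def)
        fix q assume q: "q \<in> legal_moves (insert p S)"
        note qw = white_insert_eq[OF q]
        let ?S = "insert q (insert p S)"
        have lq: "legal (play ?U p) q" using q by (simp add: legal_moves_eq pw)
        show "17 * int (dominator_moves ?S) + 34 \<le> pot ?U + 1"
          using reply[OF lq]
        proof (elim disjE exE conjE)
          assume "34 \<le> gain ?U p + gain (play ?U p) q"
          moreover have "17 * int (dominator_moves ?S) \<le> pot (white ?S) + 1"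
            by (rule IH) (use card_white_less[OF pl] card_white_less[OF q] qw pw mem_play in auto)
          ultimately show ?thesis by (simp add: gain_def qw pw)
        next
          fix r assume r: "legal (play (play ?U p) q) r"
            and g3: "50 \<le> gain ?U p + gain (play ?U p) q + gain (play (play ?U p) q) r"
            and g4: "\<forall>s. legal (play (play (play ?U p) q) r) s \<longrightarrow>
                 68 \<le> gain ?U p + gain (play ?U p) q + gain (play (play ?U p) q) r
                   + gain (play (play (play ?U p) q) r) s"
          have rl: "r \<in> legal_moves ?S" using r by (simp add: legal_moves_eq qw pw)
          note rw = white_insert_eq[OF rl]
          have "17 * int (dominator_moves ?S) \<le> pot ?U + 1 - 34"
          proof (rule two_moves[OF rl])
            \<comment> \<open>This is where the additive 1 enters: if the game ends with the third
              move, only 50 instead of 51 is available.\<close>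
            show "17 \<le> pot ?U + 1 - 34"
              using g3 pot_nonneg[of "play (play (play ?U p) q) r"] by (simp add: gain_def)
            fix s assume s: "s \<in> legal_moves (insert r ?S)"
            note sw = white_insert_eq[OF s]
            have "68 \<le> gain ?U p + gain (play ?U p) q + gain (play (play ?U p) q) r
                + gain (play (play (play ?U p) q) r) s"
              using g4 s by (simp add: legal_moves_eq rw qw pw)
            moreover have "17 * int (dominator_moves (insert s (insert r ?S)))
                \<le> pot (white (insert s (insert r ?S))) + 1"
              by (rule IH)
                (use card_white_less[OF pl] card_white_less[OF q] card_white_less[OF rl]
                  card_white_less[OF s] sw rw qw pw mem_play in auto)
            ultimately show "17 * int (dominator_moves (insert s (insert r ?S))) + 34
                \<le> pot ?U + 1 - 34"
              by (simp add: gain_def sw rw qw pw)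
          qed
          then show ?thesis by simp
        qed
      qed
    qed
  qed
qed

text \<open>\<open>pot0\<close> pays for the rounds before the position is slim. The change to
  \<open>pot\<close> takes place when Dominator is to move and does not raise the potential.\<close>

lemma bound: "17 * int (dominator_moves S) \<le> pot0 (white S) + 1"
proof (induction "card (white S)" arbitrary: S rule: less_induct)
  case less
  let ?U = "white S"
  have UV: "?U \<subseteq> pverts G" by (auto simp: white_def)
  show ?case
  proof (cases "slim ?U")
    case True
    then show ?thesis using slim_bound pot_le_pot0[OF UV] by force
  next
    case False
    then obtain u where "u \<in> ?U" "3 \<le> wdeg ?U u" using UV by (force simp: slim_def)
    then obtain p where p: "p \<in> ?U" "25 \<le> pot0 ?U - pot0 (play ?U p)"
      using pot0_opening[OF UV] by metis
    have pl: "p \<in> legal_moves S" using legal_white[OF UV p(1)] by (simp add: legal_moves_eq)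
    note pw = white_insert_eq[OF pl]
    show ?thesis
    proof (rule two_moves[OF pl])
      show "17 \<le> pot0 ?U + 1" using p(2) pot0_nonneg[of "play ?U p"] by simp
      fix q assume q: "q \<in> legal_moves (insert p S)"
      note qw = white_insert_eq[OF q]
      have "9 \<le> pot0 (play ?U p) - pot0 (play (play ?U p) q)"
        by (rule pot0_reply) (use q in \<open>simp add: legal_moves_eq pw\<close>)
      moreover have "17 * int (dominator_moves (insert q (insert p S)))
          \<le> pot0 (white (insert q (insert p S))) + 1"
        by (rule less.hyps) (use card_white_less[OF pl] card_white_less[OF q] in simp)
      ultimately show "17 * int (dominator_moves (insert q (insert p S))) + 34 \<le> pot0 ?U + 1"
        using p(2) by (simp add: qw pw)
    qed
  qed
qed

end

theorem theorem1p4: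
  fixes G :: "'a pair_pre_digraph"
  assumes "pair_graph G"
    and "\<forall>v \<in> pverts G. 2 \<le> out_degree G v"
  shows "real (pair_graph.game_domination_number G) \<le> 10 / 17 * real (card (pverts G)) + 1 / 17"
proof -
  interpret pair_graph_min_degree_two G
    using assms by (simp add: pair_graph_min_degree_two_def pair_graph_min_degree_two_axioms_def)
  have "white {} = pverts G" by (auto simp: white_def dominated_def)
  then have "17 * int game_domination_number \<le> 10 * int (card (pverts G)) + 1"
    using bound[of "{}"] by (simp add: game_domination_number_def pot0_V)
  then have "real_of_int (17 * int game_domination_number) \<le> real_of_int (10 * int (card (pverts G)) + 1)"
    by (rule iffD2[OF of_int_le_iff])
  then show ?thesis by (simp add: field_simps)
qed

end
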